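(* Let $k\ge 3$ and let $\mathcal{L}_1,\ldots,\mathcal{L}_k$ be finite sets of nonzero vectors in $\mathbb{C}^n$. Assume that for every $i\neq j\in[k]$ and every $v_i\in\mathcal{L}_i$, $v_j\in\mathcal{L}_j$ such that $v_i\not\sim v_j$, there exist $t\in[k]\setminus\{i,j\}$ and $v_t\in\mathcal{L}_t\setminus\left(\mathrm{span}\{v_i\}\cup\mathrm{span}\{v_j\}\right)$ such that $v_t\in\mathrm{span}\{v_i,v_j\}$. Then $\dim\left(\mathrm{span}\left(\bigcup_{i\in[k]}\mathcal{L}_i\right)\right)\le 4$.
   Context: For nonzero vectors $u,v$, $u\sim v$ means $v\in\mathrm{span}\{u\}$ (i.e. $u,v$ are scalar multiples of each other); $u\not\sim v$ means this fails.
   Formalization: It is additionally assumed that not exactly one of the sets L_1,…,L_k is nonempty; otherwise the claim fails, e.g. k=3, L_1 the standard basis of C^5 and L_2, L_3 empty, where the condition is vacuous but the span has dimension 5. *)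

theory Defs
  imports "HOL-Analysis.Analysis"
begin

(* vec.span and vec.dim are the span and dimension over the field of entries of the vectors,
   here the complex numbers; the unqualified span and dim would be those over the reals. *)

definition proportional :: "complex ^ 'n \<Rightarrow> complex ^ 'n \<Rightarrow> bool"  (infix "\<sim>\<^sub>C" 50)
  where "u \<sim>\<^sub>C v \<longleftrightarrow> v \<in> vec.span {u}"

(* If exactly one member of a family of vector sets is nonempty, every condition on pairs of
   vectors from two different members is void.  This excludes only that degenerate case. *)

definition no_sole_nonempty :: "nat \<Rightarrow> (nat \<Rightarrow> 'a set) \<Rightarrow> bool"
  where "no_sole_nonempty k L \<longleftrightarrow>
    (\<forall>i\<in>{1..k}. L i \<noteq> {} \<longrightarrow> (\<exists>j\<in>{1..k} - {i}. L j \<noteq> {}))"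

end

(*
  Over the projective points, two points not both belonging to one and the same single set lie on a line
  containing a third point; so the points split into classes (a point of several sets being a class of its
  own) such that a line meeting two classes meets a third.  A linear map onto C^5 preserves
  this, so it suffices to exclude such configurations spanning C^d with d >= 5.

  For suitable weights c the configuration is stable (no subspace carries more than its share of the weight),
  and a linear change of coordinates makes the normalised points e_v a tight frame:
  sum c_v e_v e_v^* is a multiple of the identity.  Put K(u,v) = |<e_u,e_v>|^2.  The sum of c_u c_v K(u,v)
  over all pairs is then W^2/d, where W is the total weight, and over the pairs inside one class it is at least
  the d-th part of the squared weight of the class.  The points of a line lie in a plane C^2, so on a line the
  sum is at least half the squared weight of the line.  Counting every pair within a class on the lines by one
  half makes the contribution of each line controllable whatever its class sizes, and comparing both estimates
  bounds the number of incidences of points and lines from below.  Since every line through v has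
  points of two further classes, there are too few lines when d >= 5.  The weights are 1, except
  that a class containing more than half of all points is given the total weight of its complement.
*)
theory Submission
  imports Defs
begin

section \<open>Tight frames by minimising a potential\<close>

lemma ln_norm_line_derivative:
  fixes a h :: "'a::real_inner"
  assumes "a \<noteq> 0"
  shows "((\<lambda>t. ln (norm (a + t *\<^sub>R h))) has_real_derivative (a \<bullet> h) / (norm a)\<^sup>2) (at 0)"
proof -
  have eq: "ln (norm (a + t *\<^sub>R h)) = ln ((norm a)\<^sup>2 + t * (2 * (a \<bullet> h)) + t\<^sup>2 * (norm h)\<^sup>2) / 2" for t :: real
  proof -
    have "(norm a)\<^sup>2 + t * (2 * (a \<bullet> h)) + t\<^sup>2 * (norm h)\<^sup>2 = (norm (a + t *\<^sub>R h))\<^sup>2"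
      unfolding power2_norm_eq_inner
      by (simp add: inner_add_left inner_add_right inner_commute[of h a] algebra_simps power2_eq_square)
    \<comment> \<open>Where the vector \<open>a + t *\<^sub>R h\<close> vanishes, both sides are 0
      by the convention \<open>ln 0 = 0\<close>.\<close>
    then show ?thesis
      by (cases "a + t *\<^sub>R h = 0") (simp_all add: ln_realpow)
  qed
  have "((\<lambda>t. ln ((norm a)\<^sup>2 + t * (2 * (a \<bullet> h)) + t\<^sup>2 * (norm h)\<^sup>2) / 2)
          has_real_derivative (a \<bullet> h) / (norm a)\<^sup>2) (at 0)"
    using assms by (auto intro!: derivative_eq_intros simp: field_simps)
  then show ?thesis
    by (simp add: eq)
qed

text \<open>First variation: for small \<open>t\<close> the matrices \<open>E t ** A\<close> form a
  curve of invertible matrices through \<open>A\<close>, so the derivative of the potential along it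
  vanishes at 0. The modulus of \<open>det (E t)\<close> enters as a separate function
  \<open>\<delta>\<close>, so that only a real derivative has to be supplied.\<close>

lemma potential_stationary:
  fixes A :: "complex^'d^'d" and E :: "real \<Rightarrow> complex^'d^'d" and \<delta> :: "real \<Rightarrow> real"
  assumes fin: "finite S"
    and nz: "\<And>v. v \<in> S \<Longrightarrow> A *v v \<noteq> 0"
    and detA: "det A \<noteq> 0"
    and min: "\<And>B. det B \<noteq> 0 \<Longrightarrow>
      (\<Sum>v\<in>S. c v * ln (norm (A *v v))) - \<kappa> * ln (cmod (det A))
        \<le> (\<Sum>v\<in>S. c v * ln (norm (B *v v))) - \<kappa> * ln (cmod (det B))"
    and E: "\<And>t x. E t *v x = x + t *\<^sub>R H x"
    and detE: "\<And>t. \<bar>t\<bar> < 1 \<Longrightarrow> cmod (det (E t)) = \<delta> t"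
    and \<delta>: "\<And>t. \<bar>t\<bar> < 1 \<Longrightarrow> \<delta> t > 0" "\<delta> 0 = 1" "(\<delta> has_real_derivative \<delta>') (at 0)"
  shows "(\<Sum>v\<in>S. c v * ((A *v v) \<bullet> H (A *v v)) / (norm (A *v v))\<^sup>2) = \<kappa> * \<delta>'"
proof -
  define g where "g t = (\<Sum>v\<in>S. c v * ln (norm (A *v v + t *\<^sub>R H (A *v v)))) - \<kappa> * ln (\<delta> t)" for t
  have der: "(g has_real_derivative
      ((\<Sum>v\<in>S. c v * ((A *v v) \<bullet> H (A *v v) / (norm (A *v v))\<^sup>2)) - \<kappa> * \<delta>')) (at 0)"
    unfolding g_def
  proof (intro DERIV_diff DERIV_sum DERIV_cmult ln_norm_line_derivative nz)
    show "((\<lambda>t. ln (\<delta> t)) has_real_derivative \<delta>') (at 0)"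
      using \<delta> by (auto intro!: derivative_eq_intros)
  qed
  have loc: "g 0 \<le> g t" if t: "\<bar>0 - t\<bar> < 1" for t
  proof -
    have t': "\<bar>t\<bar> < 1" using t by simp
    have d: "det (E t ** A) \<noteq> 0" "cmod (det (E t ** A)) = \<delta> t * cmod (det A)"
      using detE[OF t'] \<delta>(1)[OF t'] detA by (auto simp: det_mul norm_mult)
    have "ln (cmod (det (E t ** A))) = ln (\<delta> t) + ln (cmod (det A))"
      using d(2) detA \<delta>(1)[OF t'] by (simp add: ln_mult)
    moreover have "(E t ** A) *v v = A *v v + t *\<^sub>R H (A *v v)" for v
      by (simp add: matrix_vector_mul_assoc[symmetric] E)
    ultimately show ?thesis
      using min[OF d(1)] \<delta>(2) by (simp add: g_def algebra_simps)
  qed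
  have "(\<Sum>v\<in>S. c v * ((A *v v) \<bullet> H (A *v v) / (norm (A *v v))\<^sup>2)) - \<kappa> * \<delta>' = 0"
    by (rule DERIV_local_min[OF der, of 1]) (use loc in auto)
  then show ?thesis by simp
qed

lemma inner_axis_complex: "(a :: complex^'d) \<bullet> axis i z = Re (a $ i * cnj z)"
  by (simp add: inner_axis inner_complex_def)

text \<open>Two kinds of perturbation suffice: stretching a coordinate gives the diagonal entries of
  the frame operator, shearing gives the off-diagonal ones. Together they identify this operator as
  \<open>\<kappa>\<close> times the identity.\<close>

lemma stationary_imp_tight_frame:
  fixes A :: "complex^'d^'d"
  assumes fin: "finite S"
    and nz: "\<And>v. v \<in> S \<Longrightarrow> A *v v \<noteq> 0"
    and detA: "det A \<noteq> 0"
    and min: "\<And>B. det B \<noteq> 0 \<Longrightarrow>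
      (\<Sum>v\<in>S. c v * ln (norm (A *v v))) - \<kappa> * ln (cmod (det A))
        \<le> (\<Sum>v\<in>S. c v * ln (norm (B *v v))) - \<kappa> * ln (cmod (det B))"
  shows "(\<Sum>v\<in>S. of_real (c v / (norm (A *v v))\<^sup>2) * ((A *v v) $ i * cnj ((A *v v) $ j)))
           = (if i = j then of_real \<kappa> else 0)"
proof (cases "i = j")
  case True
  \<comment> \<open>\<open>E t\<close> stretches coordinate \<open>i\<close>; its determinant
    \<open>1 + t\<close> has derivative 1, which leaves \<open>\<kappa>\<close> on the
    right.\<close>
  define E :: "real \<Rightarrow> complex^'d^'d"
    where "E t = (\<chi> k l. if k = l then if k = i then of_real (1 + t) else 1 else 0)" for t
  have E: "E t *v x = x + t *\<^sub>R axis i (x $ i)" for t x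
  proof -
    have "(E t *v x) $ k = (x + t *\<^sub>R axis i (x $ i)) $ k" for k
    proof -
      have "(E t *v x) $ k = (\<Sum>l\<in>UNIV. if k = l then (if k = i then of_real (1 + t) else 1) * x $ l else 0)"
        unfolding matrix_vector_mult_def E_def vec_lambda_beta by (rule sum.cong) auto
      also have "\<dots> = (if k = i then of_real (1 + t) else 1) * x $ k"
        by (subst sum.delta') simp_all
      finally show ?thesis
        by (simp add: axis_def scaleR_conv_of_real[where 'a = complex] distrib_right)
    qed
    then show ?thesis by (simp add: vec_eq_iff)
  qed
  have "det (E t) = of_real (1 + t)" for t
    by (subst det_diagonal) (auto simp: E_def prod.delta)
  then have detE: "cmod (det (E t)) = 1 + t" if "\<bar>t\<bar> < 1" for t
    using that by (simp only: norm_of_real)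
  have "(\<Sum>v\<in>S. c v * ((A *v v) \<bullet> axis i ((A *v v) $ i)) / (norm (A *v v))\<^sup>2) = \<kappa> * 1"
    by (rule potential_stationary[OF fin nz detA min E detE])
       (auto intro!: derivative_eq_intros)
  then have *: "(\<Sum>v\<in>S. c v * (cmod ((A *v v) $ i))\<^sup>2 / (norm (A *v v))\<^sup>2) = \<kappa>"
    by (simp add: inner_axis_complex complex_mult_cnj cmod_power2)
  show ?thesis
    unfolding *[symmetric] using True
    by (simp add: complex_norm_square[symmetric])
next
  case False
  have re: "Re (\<Sum>v\<in>S. of_real (c v / (norm (A *v v))\<^sup>2) * ((A *v v) $ i * cnj (\<tau> * (A *v v) $ j))) = 0" for \<tau>
  proof -
    \<comment> \<open>A shear adding a multiple of coordinate \<open>j\<close> to coordinate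
      \<open>i\<close>; its determinant is 1, so only the vector terms contribute.\<close>
    define E :: "real \<Rightarrow> complex^'d^'d"
      where "E t = (\<chi> k. if k = i then row i (mat 1) + (of_real t * \<tau>) *s row j (mat 1) else row k (mat 1))" for t
    have E: "E t *v x = x + t *\<^sub>R axis i (\<tau> * x $ j)" for t x
    proof -
      have "(E t *v x) $ k = (x + t *\<^sub>R axis i (\<tau> * x $ j)) $ k" for k
      proof -
        have "(\<Sum>l\<in>UNIV. (if k = l then 1 else 0) * x $ l) = x $ k"
          "(\<Sum>l\<in>UNIV. (if j = l then 1 else 0) * x $ l) = x $ j" for k
          by (simp_all add: if_distrib[of "\<lambda>z. z * _"] cong: if_cong)
        then show ?thesis
          by (auto simp: matrix_vector_mult_def E_def axis_def row_def mat_def scaleR_conv_of_real[where 'a = complex]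
              distrib_right sum.distrib mult.assoc sum_distrib_left[symmetric])
      qed
      then show ?thesis by (simp add: vec_eq_iff)
    qed
    have "det (E t) = 1" for t
      unfolding E_def using det_row_operation[OF False, of "mat 1"] by simp
    then have detE: "cmod (det (E t)) = 1" for t by simp
    have "(\<Sum>v\<in>S. c v * ((A *v v) \<bullet> axis i (\<tau> * (A *v v) $ j)) / (norm (A *v v))\<^sup>2) = \<kappa> * 0"
      by (rule potential_stationary[OF fin nz detA min E detE]) auto
    moreover have "c v * ((A *v v) \<bullet> axis i (\<tau> * (A *v v) $ j)) / (norm (A *v v))\<^sup>2
        = Re (of_real (c v / (norm (A *v v))\<^sup>2) * ((A *v v) $ i * cnj (\<tau> * (A *v v) $ j)))" for v
      by (simp add: inner_axis_complex field_simps)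
    ultimately show ?thesis by simp
  qed
  define F where "F = (\<Sum>v\<in>S. of_real (c v / (norm (A *v v))\<^sup>2) * ((A *v v) $ i * cnj ((A *v v) $ j)))"
  have eq: "(\<Sum>v\<in>S. of_real (c v / (norm (A *v v))\<^sup>2) * ((A *v v) $ i * cnj (\<tau> * (A *v v) $ j))) = cnj \<tau> * F" for \<tau>
    by (simp add: F_def sum_distrib_left mult_ac)
  have "Re (cnj \<tau> * F) = 0" for \<tau>
    using re[of \<tau>] unfolding eq .
  \<comment> \<open>The values 1 and \<open>\<i>\<close> of \<open>\<tau>\<close> make the real and
    the imaginary part of \<open>F\<close> vanish.\<close>
  from this[of 1] this[of \<i>] have "F = 0" by (simp add: complex_eq_iff)
  then show ?thesis using False by (simp add: F_def)
qed

section \<open>Coercivity of the potential and existence of a minimiser\<close>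

lemma finite_uniform_bound:
  fixes f :: "'a \<Rightarrow> real"
  assumes "finite F"
  obtains K where "K > 0" "\<And>x. x \<in> F \<Longrightarrow> f x \<le> K"
proof
  \<comment> \<open>The inserted 1 keeps the maximum positive, and defined for empty
    \<open>F\<close>.\<close>
  show "Max (insert 1 (f ` F)) > 0"
    using assms by (subst Max_gr_iff) auto
  show "f x \<le> Max (insert 1 (f ` F))" if "x \<in> F" for x
    using assms that by (intro Max_ge) auto
qed

text \<open>A crude form of Hadamard's inequality: each term of the Leibniz expansion is at most the
  product of the column norms. The factorial is harmless, since it only enters a constant.\<close>

lemma norm_det_le:
  fixes M :: "complex^'d^'d"
  shows "cmod (det M) \<le> fact CARD('d) * (\<Prod>j\<in>UNIV. norm (column j M))"
proof -
  have "cmod (det (transpose M)) \<le> (\<Sum>p | p permutes (UNIV :: 'd set). (\<Prod>j\<in>UNIV. norm (column j M)))"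
    unfolding det_def
  proof (rule sum_norm_le)
    fix p :: "'d \<Rightarrow> 'd"
    have "cmod (of_int (sign p) * (\<Prod>j\<in>UNIV. transpose M $ j $ p j)) = (\<Prod>j\<in>UNIV. cmod (column j M $ p j))"
      by (simp add: norm_mult prod_norm sign_def transpose_def column_def)
    also have "\<dots> \<le> (\<Prod>j\<in>UNIV. norm (column j M))"
      by (intro prod_mono conjI norm_ge_zero Finite_Cartesian_Product.norm_nth_le)
    finally show "cmod (of_int (sign p) * (\<Prod>j\<in>UNIV. transpose M $ j $ p j)) \<le> (\<Prod>j\<in>UNIV. norm (column j M))" .
  qed
  then show ?thesis
    by (simp add: card_permutations)
qed

text \<open>Abel summation. It will be applied with partial sums of \<open>a\<close> controlled by
  stability and nonnegative increments of \<open>h\<close>.\<close>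

lemma sum_by_parts:
  fixes a h :: "nat \<Rightarrow> real"
  shows "(\<Sum>i<Suc m. a i * h i) = (\<Sum>i<Suc m. a i) * h m - (\<Sum>i<m. (\<Sum>j<Suc i. a j) * (h (Suc i) - h i))"
  by (induction m) (simp_all add: algebra_simps)

text \<open>Greedy construction: the next vector minimises \<open>x\<close> among the members of
  \<open>S\<close> outside the span reached so far. Such members exist below full dimension because
  \<open>S\<close> spans.\<close>

lemma greedy_basis:
  fixes S :: "('a::field ^ 'd) set" and x :: "'a ^ 'd \<Rightarrow> real"
  assumes "finite S" "vec.span S = UNIV"
  obtains b :: "nat \<Rightarrow> 'a ^ 'd" where
    "\<And>i. i < CARD('d) \<Longrightarrow> b i \<in> S"
    "\<And>i. i \<le> CARD('d) \<Longrightarrow> vec.dim (vec.span (b ` {..<i})) = i"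
    "\<And>i v. i < CARD('d) \<Longrightarrow> v \<in> S \<Longrightarrow> v \<notin> vec.span (b ` {..<i}) \<Longrightarrow> x (b i) \<le> x v"
proof -
  define g where "g X = (SOME v. v \<in> S - vec.span X \<and> (\<forall>w \<in> S - vec.span X. x v \<le> x w))" for X
  define U where "U = rec_nat {} (\<lambda>_ X. insert (g X) X)"
  define b where "b n = g (U n)" for n
  have U: "U n = b ` {..<n}" for n
  proof (induction n)
    case (Suc n)
    have "U (Suc n) = insert (b n) (U n)"
      by (simp add: U_def b_def)
    then show ?case using Suc by (simp add: lessThan_Suc)
  qed (simp add: U_def)
  have g: "g X \<in> S - vec.span X \<and> (\<forall>w \<in> S - vec.span X. x (g X) \<le> x w)"
    if "vec.dim X < CARD('d)" for X
    unfolding g_def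
  proof (rule someI_ex)
    have "S - vec.span X \<noteq> {}"
    proof
      assume "S - vec.span X = {}"
      then have "vec.span S \<subseteq> vec.span X" by (intro vec.span_minimal) auto
      then have "vec.span X = UNIV" using assms by auto
      then have "vec.dim X = vec.dim (UNIV :: ('a^'d) set)"
        by (metis vec.dim_span)
      then show False using that by (simp only: vec_dim_card)
    qed
    then show "\<exists>v. v \<in> S - vec.span X \<and> (\<forall>w \<in> S - vec.span X. x v \<le> x w)"
      using ex_is_arg_min_if_finite[of "S - vec.span X" x] assms(1)
      by (auto simp: is_arg_min_linorder)
  qed
  have dimU: "vec.dim (U n) = n" if "n \<le> CARD('d)" for n
    using that
  proof (induction n)
    case (Suc n)
    then have "g (U n) \<notin> vec.span (U n)" using g[of "U n"] by auto
    moreover have "U (Suc n) = insert (g (U n)) (U n)" by (simp add: U_def)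
    ultimately show ?case using Suc by (simp add: vec.dim_insert)
  qed (simp add: U_def)
  show ?thesis
  proof (rule that[of b])
    show "b i \<in> S" if "i < CARD('d)" for i
      using g[of "U i"] dimU[of i] that by (simp add: b_def)
    show "vec.dim (vec.span (b ` {..<i})) = i" if "i \<le> CARD('d)" for i
      using dimU[OF that] by (simp add: U)
    show "x (b i) \<le> x v" if "i < CARD('d)" "v \<in> S" "v \<notin> vec.span (b ` {..<i})" for i v
      using g[of "U i"] dimU[of i] that unfolding U[symmetric] by (simp add: b_def)
  qed
qed

text \<open>Each \<open>v\<close> is charged to the greedy vector at which it enters the flag, whose
  \<open>h\<close> is at most \<open>h v\<close>. Abel summation turns the slack of the proper flag
  members into \<open>\<delta>\<close> times the spread of \<open>h\<close> over the basis. This is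
  how stability becomes coercivity.\<close>

lemma greedy_weight_bound:
  fixes S :: "('a::field ^ 'd) set" and c h :: "'a ^ 'd \<Rightarrow> real" and \<kappa> \<delta> :: real
  assumes S: "finite S" "vec.span S = UNIV" "0 \<notin> S"
    and c: "\<And>v. v \<in> S \<Longrightarrow> c v \<ge> 0"
    and total: "(\<Sum>v\<in>S. c v) = \<kappa> * CARD('d)"
    and slack: "\<And>X. X \<subseteq> S \<Longrightarrow> X \<noteq> {} \<Longrightarrow> vec.span X \<noteq> UNIV \<Longrightarrow>
      (\<Sum>v\<in>S \<inter> vec.span X. c v) + \<delta> \<le> \<kappa> * vec.dim X"
    and bS: "\<And>i. i < CARD('d) \<Longrightarrow> b i \<in> S"
    and dim: "\<And>i. i \<le> CARD('d) \<Longrightarrow> vec.dim (vec.span (b ` {..<i})) = i"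
    and greedy: "\<And>i v. i < CARD('d) \<Longrightarrow> v \<in> S \<Longrightarrow> v \<notin> vec.span (b ` {..<i}) \<Longrightarrow> h (b i) \<le> h v"
  shows "\<kappa> * (\<Sum>i<CARD('d). h (b i)) + \<delta> * (h (b (CARD('d) - 1)) - h (b 0)) \<le> (\<Sum>v\<in>S. c v * h v)"
proof -
  define m where "m = CARD('d) - 1"
  have d: "CARD('d) = Suc m" by (simp add: m_def)
  \<comment> \<open>\<open>r v\<close> is the step at which \<open>v\<close> enters the flag:
    \<open>v\<close> lies in the span of the first \<open>r v + 1\<close> vectors, but not of the
    first \<open>r v\<close>.\<close>
  define r where "r v = (LEAST i. v \<in> vec.span (b ` {..<Suc i}))" for v
  have full: "vec.span (b ` {..<CARD('d)}) = UNIV"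
    by (rule vec.subspace_dim_equal) (use dim[of "CARD('d)"] in \<open>simp_all add: vec_dim_card del: vec.dim_UNIV vec.dim_span\<close>)
  have r: "v \<in> vec.span (b ` {..<Suc i}) \<longleftrightarrow> r v \<le> i" for v i
  proof
    show "v \<in> vec.span (b ` {..<Suc i}) \<Longrightarrow> r v \<le> i"
      unfolding r_def by (rule Least_le)
  next
    have "v \<in> vec.span (b ` {..<Suc m})" using full by (simp add: d)
    then have "v \<in> vec.span (b ` {..<Suc (r v)})"
      unfolding r_def by (rule LeastI)
    moreover assume "r v \<le> i"
    ultimately show "v \<in> vec.span (b ` {..<Suc i})"
      using vec.span_mono[of "b ` {..<Suc (r v)}" "b ` {..<Suc i}"] by (meson Suc_le_mono image_mono lessThan_subset_iff subsetD)
  qed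
  have rm: "r v \<le> m" for v using r[of v m] full by (simp add: d)
  have hr: "h (b (r v)) \<le> h v" if "v \<in> S" for v
  proof (rule greedy)
    show "r v < CARD('d)" using rm[of v] d by simp
    show "v \<notin> vec.span (b ` {..<r v})"
    proof (cases "r v")
      \<comment> \<open>The span of no vectors contains only 0, which is not in
        \<open>S\<close>.\<close>
      case 0
      then show ?thesis using that S(3) by auto
    next
      case (Suc i)
      then show ?thesis using r[of v i] by simp
    qed
  qed fact
  have mono: "h (b i) \<le> h (b (Suc i))" if "i < m" for i
  proof (rule greedy)
    show "i < CARD('d)" "b (Suc i) \<in> S" using that d bS by auto
    show "b (Suc i) \<notin> vec.span (b ` {..<i})"
    proof
      assume "b (Suc i) \<in> vec.span (b ` {..<i})"
      then have "b (Suc i) \<in> vec.span (b ` {..<Suc i})"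
        using vec.span_mono[of "b ` {..<i}" "b ` {..<Suc i}"] by (meson image_mono lessThan_subset_iff le_SucI order_refl subsetD)
      moreover have "b ` {..<Suc (Suc i)} = insert (b (Suc i)) (b ` {..<Suc i})"
        by (simp add: lessThan_Suc insert_commute)
      ultimately have "vec.span (b ` {..<Suc (Suc i)}) = vec.span (b ` {..<Suc i})"
        by (simp add: vec.span_redundant)
      then show False using dim[of "Suc i"] dim[of "Suc (Suc i)"] that d by simp
    qed
  qed
  \<comment> \<open>\<open>a i\<close> is the excess over \<open>\<kappa>\<close> of the weight
    gained at step \<open>i\<close>. The proper partial sums are at most \<open>- \<delta>\<close>,
    the full sum is 0.\<close>
  define a where "a i = (\<Sum>v | v \<in> S \<and> r v = i. c v) - \<kappa>" for i
  have group: "(\<Sum>i<k. \<Sum>v | v \<in> S \<and> r v = i. f v) = (\<Sum>v | v \<in> S \<and> r v < k. f v)" for k and f :: "'a ^ 'd \<Rightarrow> real"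
  proof -
    have "(\<Sum>i<k. \<Sum>v | v \<in> S \<and> r v = i. f v) = (\<Sum>i<k. \<Sum>v | v \<in> {v \<in> S. r v < k} \<and> r v = i. f v)"
      by (intro sum.cong) auto
    also have "\<dots> = (\<Sum>v | v \<in> S \<and> r v < k. f v)"
      using S(1) by (intro sum.group) auto
    finally show ?thesis .
  qed
  have partial: "(\<Sum>j<Suc i. a j) \<le> - \<delta>" if "i < m" for i
  proof -
    have "{v \<in> S. r v < Suc i} = S \<inter> vec.span (b ` {..<Suc i})"
      using r by (auto simp: less_Suc_eq_le)
    then have "(\<Sum>j<Suc i. a j) = (\<Sum>v\<in>S \<inter> vec.span (b ` {..<Suc i}). c v) - \<kappa> * Suc i"
      using group[of c "Suc i"] by (simp add: a_def sum_subtractf del: sum.lessThan_Suc)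
    moreover have "(\<Sum>v\<in>S \<inter> vec.span (b ` {..<Suc i}). c v) + \<delta> \<le> \<kappa> * vec.dim (b ` {..<Suc i})"
    proof (rule slack)
      show "b ` {..<Suc i} \<subseteq> S" using bS that d by auto
      show "vec.span (b ` {..<Suc i}) \<noteq> UNIV"
      proof
        assume "vec.span (b ` {..<Suc i}) = UNIV"
        then have "vec.dim (vec.span (b ` {..<Suc i})) = CARD('d)" by (simp add: card_cart_basis)
        then show False using dim[of "Suc i"] that d by simp
      qed
    qed auto
    ultimately show ?thesis using dim[of "Suc i"] that d by simp
  qed
  have all: "(\<Sum>j<Suc m. a j) = 0"
  proof -
    have "{v \<in> S. r v < Suc m} = S" using rm by (auto simp: less_Suc_eq_le)
    then show ?thesis
      using group[of c "Suc m"] total d by (simp add: a_def sum_subtractf del: sum.lessThan_Suc)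
  qed
  have "\<delta> * (h (b m) - h (b 0)) = (\<Sum>i<m. \<delta> * (h (b (Suc i)) - h (b i)))"
    by (simp add: sum_distrib_left[symmetric] sum_lessThan_telescope[of "\<lambda>i. h (b i)"])
  also have "\<dots> \<le> - (\<Sum>i<m. (\<Sum>j<Suc i. a j) * (h (b (Suc i)) - h (b i)))"
    unfolding sum_negf[symmetric]
  proof (rule sum_mono)
    fix i assume "i \<in> {..<m}"
    then have "(\<delta> + (\<Sum>j<Suc i. a j)) * (h (b (Suc i)) - h (b i)) \<le> 0"
      using partial[of i] mono[of i] by (intro mult_nonpos_nonneg) auto
    then show "\<delta> * (h (b (Suc i)) - h (b i)) \<le> - ((\<Sum>j<Suc i. a j) * (h (b (Suc i)) - h (b i)))"
      by (simp add: algebra_simps)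
  qed
  also have "\<dots> = (\<Sum>i<Suc m. a i * h (b i))"
    using sum_by_parts[of a "\<lambda>i. h (b i)" m] all by simp
  also have "\<dots> = (\<Sum>i<Suc m. \<Sum>v | v \<in> S \<and> r v = i. c v * h (b (r v))) - \<kappa> * (\<Sum>i<Suc m. h (b i))"
    by (simp add: a_def left_diff_distrib sum_subtractf sum_distrib_left sum_distrib_right del: sum.lessThan_Suc)
  also have "(\<Sum>i<Suc m. \<Sum>v | v \<in> S \<and> r v = i. c v * h (b (r v))) = (\<Sum>v\<in>S. c v * h (b (r v)))"
    unfolding group using rm by (simp add: less_Suc_eq_le)
  also have "\<dots> \<le> (\<Sum>v\<in>S. c v * h v)"
    by (intro sum_mono mult_left_mono hr c)
  finally show ?thesis by (simp add: d)
qed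

text \<open>A positive scalar factor of \<open>A\<close> does not change the potential, because the
  total weight is \<open>\<kappa>\<close> times the dimension. After normalisation, strict stability
  confines the matrices of small potential to a compact set of invertible ones. Hence a minimiser
  exists, and stationarity makes it a tight frame.\<close>

lemma exists_tight_frame:
  fixes S :: "(complex ^ 'd) set" and c :: "complex ^ 'd \<Rightarrow> real" and \<kappa> :: real
  assumes S: "finite S" "vec.span S = UNIV" "0 \<notin> S"
    and c: "\<And>v. v \<in> S \<Longrightarrow> c v > 0"
    and \<kappa>: "\<kappa> > 0" "(\<Sum>v\<in>S. c v) = \<kappa> * CARD('d)"
    and stable: "\<And>X. X \<subseteq> S \<Longrightarrow> X \<noteq> {} \<Longrightarrow> vec.span X \<noteq> UNIV \<Longrightarrow>
      (\<Sum>v\<in>S \<inter> vec.span X. c v) < \<kappa> * vec.dim X"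
  obtains A :: "complex ^ 'd ^ 'd" where "det A \<noteq> 0"
    "\<And>i j. (\<Sum>v\<in>S. of_real (c v / (norm (A *v v))\<^sup>2) * ((A *v v) $ i * cnj ((A *v v) $ j)))
           = (if i = j then of_real \<kappa> else 0)"
proof -
  define \<Phi> where "\<Phi> A = (\<Sum>v\<in>S. c v * ln (norm (A *v v))) - \<kappa> * ln (cmod (det A))" for A :: "complex^'d^'d"
  obtain \<delta> where \<delta>: "\<delta> > 0" "\<And>X. X \<subseteq> S \<Longrightarrow> X \<noteq> {} \<Longrightarrow> vec.span X \<noteq> UNIV \<Longrightarrow>
      (\<Sum>v\<in>S \<inter> vec.span X. c v) + \<delta> \<le> \<kappa> * vec.dim X"
  proof -
    \<comment> \<open>Only finitely many \<open>X\<close> occur, so the positive gaps in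
      \<open>stable\<close> have a common positive lower bound, obtained by bounding their
      reciprocals.\<close>
    have "finite {X \<in> Pow S. X \<noteq> {} \<and> vec.span X \<noteq> UNIV}" using S(1) by simp
    then obtain K where K: "K > 0" "\<And>X. X \<in> {X \<in> Pow S. X \<noteq> {} \<and> vec.span X \<noteq> UNIV} \<Longrightarrow>
        1 / (\<kappa> * vec.dim X - (\<Sum>v\<in>S \<inter> vec.span X. c v)) \<le> K"
      by (rule finite_uniform_bound[where f = "\<lambda>X. 1 / (\<kappa> * vec.dim X - (\<Sum>v\<in>S \<inter> vec.span X. c v))"]) blast
    show thesis
    proof (rule that[of "1 / K"])
      show "1 / K > 0" using K by simp
      fix X assume X: "X \<subseteq> S" "X \<noteq> {}" "vec.span X \<noteq> UNIV"
      from K(2)[of X] X have "1 / (\<kappa> * vec.dim X - (\<Sum>v\<in>S \<inter> vec.span X. c v)) \<le> K" by simp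
      with stable[OF X] K(1) have "1 / K \<le> \<kappa> * vec.dim X - (\<Sum>v\<in>S \<inter> vec.span X. c v)"
        by (simp add: field_simps)
      then show "(\<Sum>v\<in>S \<inter> vec.span X. c v) + 1 / K \<le> \<kappa> * vec.dim X" by simp
    qed
  qed
  define M where "M \<sigma> = (\<chi> i j. \<sigma> j $ i)" for \<sigma> :: "'d \<Rightarrow> complex ^ 'd"
  have fin: "finite (UNIV \<rightarrow>\<^sub>E S :: ('d \<Rightarrow> complex ^ 'd) set)"
    using S(1) by (intro finite_PiE) auto
  \<comment> \<open>\<open>K1\<close> and \<open>K2\<close> are uniform over all choices of columns
    from \<open>S\<close>, because the greedy basis varies with \<open>A\<close>. Singular choices
    do no harm: division by 0 gives 0 in \<open>K1\<close>, and \<open>matrix_inv\<close> has some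
    fixed value in \<open>K2\<close>.\<close>
  obtain K1 where K1: "K1 > 0" "\<And>\<sigma>. \<sigma> \<in> UNIV \<rightarrow>\<^sub>E S \<Longrightarrow> fact CARD('d) / cmod (det (M \<sigma>)) \<le> K1"
    using finite_uniform_bound[OF fin, of "\<lambda>\<sigma>. fact CARD('d) / cmod (det (M \<sigma>))"] by metis
  obtain K2 where K2: "K2 > 0"
    "\<And>\<sigma>. \<sigma> \<in> UNIV \<rightarrow>\<^sub>E S \<Longrightarrow> (\<Sum>k\<in>UNIV. \<Sum>j\<in>UNIV. cmod (matrix_inv (M \<sigma>) $ k $ j)) \<le> K2"
    using finite_uniform_bound[OF fin, of "\<lambda>\<sigma>. \<Sum>k\<in>UNIV. \<Sum>j\<in>UNIV. cmod (matrix_inv (M \<sigma>) $ k $ j)"] by metis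
  define \<Phi>0 where "\<Phi>0 = \<Phi> (mat 1)"
  \<comment> \<open>\<open>R\<close> will bound the entries of \<open>A\<close>, recovered from
    \<open>A ** M \<sigma>\<close> and the inverse of \<open>M \<sigma>\<close>. The bound
    \<open>\<epsilon>\<close> on the determinant comes from dropping the nonnegative logarithms in
    \<open>\<Phi>\<close>.\<close>
  define R where "R = exp ((\<Phi>0 + \<kappa> * ln K1) / \<delta>) * K2"
  define \<epsilon> where "\<epsilon> = exp (- \<Phi>0 / \<kappa>)"
  define \<K> where "\<K> = {A :: complex^'d^'d. (\<forall>i j. cmod (A $ i $ j) \<le> R) \<and> \<epsilon> \<le> cmod (det A)}"

  have nz: "A *v v \<noteq> 0" if "det A \<noteq> 0" "v \<in> S" for A :: "complex^'d^'d" and v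
  proof
    assume "A *v v = 0"
    moreover have "invertible A" using that by (simp add: invertible_det_nz)
    ultimately have "v = 0" by (metis invertible_def matrix_left_invertible_ker)
    then show False using that S(3) by simp
  qed

  have coercive: "A \<in> \<K>"
    if A: "det A \<noteq> 0" "\<And>v. v \<in> S \<Longrightarrow> norm (A *v v) \<ge> 1" "v0 \<in> S" "norm (A *v v0) = 1" "\<Phi> A \<le> \<Phi>0"
    for A :: "complex^'d^'d" and v0
  proof -
    define h where "h v = ln (norm (A *v v))" for v
    have h0: "h v \<ge> 0" if "v \<in> S" for v using A(2)[OF that] by (simp add: h_def)
    obtain b where b: "\<And>i. i < CARD('d) \<Longrightarrow> b i \<in> S"
      "\<And>i. i \<le> CARD('d) \<Longrightarrow> vec.dim (vec.span (b ` {..<i})) = i"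
      "\<And>i v. i < CARD('d) \<Longrightarrow> v \<in> S \<Longrightarrow> v \<notin> vec.span (b ` {..<i}) \<Longrightarrow> h (b i) \<le> h v"
      by (rule greedy_basis[OF S(1,2), of h]) (rule that)
    \<comment> \<open>The first greedy vector minimises \<open>h\<close> on \<open>S\<close>, where
      \<open>v0\<close> attains 0; so the spread of \<open>h\<close> is just its last value
      \<open>t\<close>.\<close>
    have "h (b 0) \<le> h v0" using b(3)[of 0 v0] A(3) S(3) by auto
    then have hb0: "h (b 0) = 0" using h0[OF b(1)[of 0]] A(4) by (simp add: h_def)
    obtain m where m: "CARD('d) = Suc m"
      using zero_less_card_finite[where 'a = 'd] by (cases "CARD('d)") auto
    define t where "t = h (b m)"
    have ht: "h (b i) \<le> t" if i: "i < CARD('d)" for i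
      unfolding t_def
    proof (rule b(3)[OF i])
      show "b m \<in> S" by (rule b(1)) (simp add: m)
      show "b m \<notin> vec.span (b ` {..<i})"
      proof
        assume "b m \<in> vec.span (b ` {..<i})"
        moreover have "b ` {..<i} \<subseteq> b ` {..<m}" using i m by auto
        ultimately have "b m \<in> vec.span (b ` {..<m})" using vec.span_mono by blast
        then have "vec.span (b ` {..<Suc m}) = vec.span (b ` {..<m})"
          by (simp add: lessThan_Suc vec.span_redundant)
        then show False using b(2)[of "Suc m"] b(2)[of m] m by simp
      qed
    qed
    have weight: "\<kappa> * (\<Sum>i<CARD('d). h (b i)) + \<delta> * t \<le> (\<Sum>v\<in>S. c v * h v)"
      using greedy_weight_bound[OF S, of c \<kappa> \<delta> b h] c \<kappa> \<delta>(2) b hb0 m by (simp add: t_def less_imp_le)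

    obtain e :: "'d \<Rightarrow> nat" where e: "bij_betw e UNIV {..<CARD('d)}"
      using ex_bij_betw_finite_nat[of "UNIV :: 'd set"] by (auto simp: lessThan_atLeast0)
    define \<sigma> where "\<sigma> = b \<circ> e"
    have \<sigma>S: "\<sigma> \<in> UNIV \<rightarrow>\<^sub>E S"
      using e b(1) by (auto simp: \<sigma>_def PiE_def extensional_def dest!: bij_betwE)
    have col: "column j (A ** M \<sigma>) = A *v b (e j)" for j
      by (simp add: vec_eq_iff column_def matrix_matrix_mult_def matrix_vector_mult_def M_def \<sigma>_def)
    have cols: "columns (M \<sigma>) = b ` {..<CARD('d)}"
    proof -
      have "columns (M \<sigma>) = range \<sigma>"
        by (auto simp: columns_def column_def M_def vec_lambda_eta)
      also have "\<dots> = b ` {..<CARD('d)}" unfolding \<sigma>_def image_comp[symmetric] using bij_betw_imp_surj_on[OF e] by simp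
      finally show ?thesis .
    qed
    have "vec.span (b ` {..<CARD('d)}) = UNIV"
      by (rule vec.subspace_dim_equal) (use b(2)[of "CARD('d)"] in \<open>simp_all add: vec_dim_card del: vec.dim_UNIV vec.dim_span\<close>)
    then obtain B where "M \<sigma> ** B = mat 1"
      using matrix_right_invertible_span_columns[of "M \<sigma>"] cols by auto
    then have inv: "invertible (M \<sigma>)" using invertible_right_inverse by blast
    then have minv: "M \<sigma> ** matrix_inv (M \<sigma>) = mat 1"
      unfolding invertible_def matrix_inv_def by (rule someI2_ex) blast
    from inv have detM: "det (M \<sigma>) \<noteq> 0" by (simp add: invertible_det_nz)
    have bnz: "A *v b i \<noteq> 0" if "i < CARD('d)" for i
      using A(2)[OF b(1)[OF that]] by auto
    have hsum: "ln (\<Prod>j\<in>UNIV. norm (A *v b (e j))) = (\<Sum>i<CARD('d). h (b i))"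
    proof -
      have "ln (\<Prod>j\<in>UNIV. norm (A *v b (e j))) = (\<Sum>j\<in>UNIV. h (b (e j)))"
        unfolding h_def using bij_betwE[OF e] by (intro ln_prod) (auto simp: bnz)
      also have "\<dots> = (\<Sum>i<CARD('d). h (b i))" by (rule sum.reindex_bij_betw[OF e])
      finally show ?thesis .
    qed
    have "cmod (det A) * cmod (det (M \<sigma>)) \<le> fact CARD('d) * (\<Prod>j\<in>UNIV. norm (A *v b (e j)))"
      using norm_det_le[of "A ** M \<sigma>"] by (simp add: det_mul norm_mult col)
    then have "cmod (det A) \<le> fact CARD('d) / cmod (det (M \<sigma>)) * (\<Prod>j\<in>UNIV. norm (A *v b (e j)))"
      using detM by (simp add: field_simps)
    also have "\<dots> \<le> K1 * (\<Prod>j\<in>UNIV. norm (A *v b (e j)))"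
      by (intro mult_right_mono K1 \<sigma>S prod_nonneg) auto
    finally have "ln (cmod (det A)) \<le> ln (K1 * (\<Prod>j\<in>UNIV. norm (A *v b (e j))))"
      using A(1) by (intro ln_mono) auto
    also have "\<dots> = ln K1 + (\<Sum>i<CARD('d). h (b i))"
      unfolding hsum[symmetric] using K1(1) bij_betwE[OF e]
      by (subst ln_mult) (auto simp: bnz)
    finally have "\<kappa> * ln (cmod (det A)) \<le> \<kappa> * (ln K1 + (\<Sum>i<CARD('d). h (b i)))"
      using \<kappa>(1) by simp
    \<comment> \<open>The sum of the \<open>h (b i)\<close> cancels against the one in
      \<open>weight\<close>.\<close>
    then have "\<delta> * t \<le> \<Phi>0 + \<kappa> * ln K1"
      using weight A(5) by (simp add: \<Phi>_def h_def[symmetric] distrib_left)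
    then have t: "t \<le> (\<Phi>0 + \<kappa> * ln K1) / \<delta>"
      using \<delta>(1) by (simp add: field_simps)
    have colbound: "cmod ((A ** M \<sigma>) $ i $ k) \<le> exp ((\<Phi>0 + \<kappa> * ln K1) / \<delta>)" for i k
    proof -
      have "cmod ((A ** M \<sigma>) $ i $ k) = cmod (column k (A ** M \<sigma>) $ i)"
        by (simp add: column_def)
      also have "\<dots> \<le> norm (A *v b (e k))"
        unfolding col by (rule Finite_Cartesian_Product.norm_nth_le)
      also have "\<dots> = exp (h (b (e k)))"
        using bnz[of "e k"] bij_betwE[OF e] by (simp add: h_def)
      also have "\<dots> \<le> exp ((\<Phi>0 + \<kappa> * ln K1) / \<delta>)"
        using ht[of "e k"] bij_betwE[OF e] t by simp
      finally show ?thesis .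
    qed
    have "cmod (A $ i $ j) \<le> R" for i j
    proof -
      have entry: "(X ** Y) $ i $ j = (\<Sum>k\<in>UNIV. X $ i $ k * Y $ k $ j)" for X Y :: "complex^'d^'d"
        by (simp add: matrix_matrix_mult_def)
      have "(A ** M \<sigma>) ** matrix_inv (M \<sigma>) = A"
        using minv by (simp add: matrix_mul_assoc[symmetric])
      then have "A $ i $ j = ((A ** M \<sigma>) ** matrix_inv (M \<sigma>)) $ i $ j" by simp
      also have "\<dots> = (\<Sum>k\<in>UNIV. (A ** M \<sigma>) $ i $ k * matrix_inv (M \<sigma>) $ k $ j)"
        by (rule entry)
      also have "cmod \<dots> \<le> (\<Sum>k\<in>UNIV. exp ((\<Phi>0 + \<kappa> * ln K1) / \<delta>) * cmod (matrix_inv (M \<sigma>) $ k $ j))"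
        by (intro sum_norm_le) (simp add: norm_mult mult_right_mono colbound)
      also have "\<dots> = exp ((\<Phi>0 + \<kappa> * ln K1) / \<delta>) * (\<Sum>k\<in>UNIV. cmod (matrix_inv (M \<sigma>) $ k $ j))"
        by (simp add: sum_distrib_left)
      also have "\<dots> \<le> exp ((\<Phi>0 + \<kappa> * ln K1) / \<delta>) * (\<Sum>k\<in>UNIV. \<Sum>j\<in>UNIV. cmod (matrix_inv (M \<sigma>) $ k $ j))"
        by (intro mult_left_mono sum_mono member_le_sum) auto
      also have "\<dots> \<le> R"
        unfolding R_def by (intro mult_left_mono K2 \<sigma>S) auto
      finally show ?thesis .
    qed
    moreover have "\<epsilon> \<le> cmod (det A)"
    proof -
      have "0 \<le> (\<Sum>v\<in>S. c v * h v)"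
        using c h0 by (intro sum_nonneg mult_nonneg_nonneg) (auto simp: less_imp_le)
      then have "- \<Phi>0 / \<kappa> \<le> ln (cmod (det A))"
        using A(5) \<kappa>(1) by (simp add: \<Phi>_def h_def[symmetric] field_simps)
      then show ?thesis using A(1) by (simp add: \<epsilon>_def ln_ge_iff)
    qed
    ultimately show ?thesis by (simp add: \<K>_def)
  qed

  have normalise: "\<exists>B\<in>\<K>. \<Phi> B = \<Phi> A" if A: "det A \<noteq> 0" "\<Phi> A \<le> \<Phi>0" for A :: "complex^'d^'d"
  proof -
    have "S \<noteq> {}"
    proof
      assume "S = {}"
      then have "vec.dim (vec.span S) = 0" by simp
      then show False using S(2) vec_dim_card[where 'a = complex and 'n = 'd] by simp
    qed
    then obtain v0 where v0: "v0 \<in> S" "\<And>v. v \<in> S \<Longrightarrow> norm (A *v v0) \<le> norm (A *v v)"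
      using ex_is_arg_min_if_finite[of S "\<lambda>v. norm (A *v v)"] S(1) by (auto simp: is_arg_min_linorder)
    \<comment> \<open>Scaling by \<open>r\<close> turns the shortest image of a member of
      \<open>S\<close> into a unit vector, as \<open>coercive\<close> demands.\<close>
    define r where "r = inverse (norm (A *v v0))"
    have r: "r > 0" using nz[OF A(1) v0(1)] by (simp add: r_def)
    define B where "B = (mat (of_real r) :: complex^'d^'d) ** A"
    have scal: "(mat (of_real r) :: complex^'d^'d) *v x = r *\<^sub>R x" for x
    proof -
      have "((mat (of_real r) :: complex^'d^'d) *v x) $ i = of_real r * x $ i" for i
      proof -
        have "((mat (of_real r) :: complex^'d^'d) *v x) $ i = (\<Sum>j\<in>UNIV. if i = j then of_real r * x $ j else 0)"
          unfolding matrix_vector_mult_def mat_def vec_lambda_beta by (rule sum.cong) auto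
        also have "\<dots> = of_real r * x $ i" by (subst sum.delta') simp_all
        finally show ?thesis .
      qed
      then show ?thesis by (simp add: vec_eq_iff scaleR_conv_of_real[where 'a = complex])
    qed
    have Bv: "norm (B *v v) = r * norm (A *v v)" for v
      using r by (simp add: B_def matrix_vector_mul_assoc[symmetric] scal)
    have "det (mat (of_real r) :: complex^'d^'d) = of_real r ^ CARD('d)"
      by (subst det_diagonal) (auto simp: mat_def)
    then have detB: "cmod (det B) = r ^ CARD('d) * cmod (det A)"
      using r by (simp add: B_def det_mul norm_mult norm_power)
    have "\<Phi> B = (\<Sum>v\<in>S. c v * ln r + c v * ln (norm (A *v v))) - \<kappa> * (CARD('d) * ln r + ln (cmod (det A)))"
      unfolding \<Phi>_def using r A(1) nz[OF A(1)]
      by (simp add: Bv detB ln_mult ln_realpow distrib_left cong: sum.cong)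
    also have "(\<Sum>v\<in>S. c v * ln r + c v * ln (norm (A *v v)))
        = \<kappa> * CARD('d) * ln r + (\<Sum>v\<in>S. c v * ln (norm (A *v v)))"
      by (simp add: sum.distrib sum_distrib_right[symmetric] \<kappa>(2))
    finally have \<Phi>B: "\<Phi> B = \<Phi> A"
      by (simp add: \<Phi>_def distrib_left)
    have "B \<in> \<K>"
    proof (rule coercive)
      show "det B \<noteq> 0" using detB r A(1) by auto
      show "norm (B *v v) \<ge> 1" if "v \<in> S" for v
        using v0(2)[OF that] nz[OF A(1) v0(1)] by (simp add: Bv r_def field_simps)
      show "v0 \<in> S" by fact
      show "norm (B *v v0) = 1" using nz[OF A(1) v0(1)] by (simp add: Bv r_def)
      show "\<Phi> B \<le> \<Phi>0" using \<Phi>B A(2) by simp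
    qed
    then show ?thesis using \<Phi>B by blast
  qed

  have cont_det: "continuous_on X (\<lambda>A :: complex^'d^'d. det A)" for X
    unfolding det_def by (intro continuous_intros)
  have "compact \<K>"
  proof (rule compact_eq_bounded_closed[THEN iffD2], intro conjI)
    have "norm A \<le> (\<Sum>i\<in>(UNIV::'d set). \<Sum>j\<in>(UNIV::'d set). R)" if "A \<in> \<K>" for A
    proof -
      have "norm A \<le> (\<Sum>i\<in>UNIV. norm (A $ i))"
        unfolding norm_vec_def by (rule L2_set_le_sum) simp
      also have "\<dots> \<le> (\<Sum>i\<in>UNIV. \<Sum>j\<in>UNIV. cmod (A $ i $ j))"
        by (rule sum_mono) (auto simp: norm_vec_def intro!: L2_set_le_sum)
      also have "\<dots> \<le> (\<Sum>i\<in>(UNIV::'d set). \<Sum>j\<in>(UNIV::'d set). R)"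
        using that by (intro sum_mono) (auto simp: \<K>_def)
      finally show ?thesis .
    qed
    then show "bounded \<K>" unfolding bounded_iff by blast
    show "closed \<K>"
      unfolding \<K>_def
      by (intro closed_Collect_conj closed_Collect_all closed_Collect_le continuous_intros cont_det)
  qed
  moreover have "\<K> \<noteq> {}"
    using normalise[of "mat 1"] by (auto simp: \<Phi>0_def)
  moreover have "continuous_on \<K> \<Phi>"
  proof -
    have detnz: "det A \<noteq> 0" if "A \<in> \<K>" for A
    proof -
      have "\<epsilon> > 0" by (simp add: \<epsilon>_def)
      then show ?thesis using that by (auto simp: \<K>_def)
    qed
    show ?thesis
      unfolding \<Phi>_def matrix_vector_mult_def
      by (intro continuous_intros cont_det)
         (use nz[unfolded matrix_vector_mult_def] detnz in auto)
  qed
  ultimately obtain A where A: "A \<in> \<K>" "\<And>B. B \<in> \<K> \<Longrightarrow> \<Phi> A \<le> \<Phi> B"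
    using continuous_attains_inf[of \<K> \<Phi>] by blast
  have detA: "det A \<noteq> 0"
  proof -
    have "\<epsilon> > 0" by (simp add: \<epsilon>_def)
    then show ?thesis using A(1) by (auto simp: \<K>_def)
  qed
  obtain B0 where "B0 \<in> \<K>" "\<Phi> B0 = \<Phi>0"
    using normalise[of "mat 1"] by (auto simp: \<Phi>0_def)
  with A(2)[of B0] have "\<Phi> A \<le> \<Phi>0" by simp
  then have min: "\<Phi> A \<le> \<Phi> B" if "det B \<noteq> 0" for B
    using normalise[of B] that A(2) by (metis linear order.trans)
  show thesis
    using that[OF detA] stationary_imp_tight_frame[OF S(1) nz[OF detA] detA, of c \<kappa>] min
    by (simp add: \<Phi>_def)
qed

section \<open>Configurations with classes\<close>

text \<open>
  The vectors in \<open>S\<close> represent distinct projective points. Compared with the sets in the theorem, a class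
  is either the set of points lying in exactly one given member of the family or a single point lying in several.
\<close>

locale coloured_configuration =
  fixes S :: "(complex ^ 'd) set" and cls :: "complex ^ 'd \<Rightarrow> 'c"
  assumes finite_S: "finite S"
    and nonproportional: "\<And>u v. u \<in> S \<Longrightarrow> v \<in> S \<Longrightarrow> u \<in> vec.span {v} \<Longrightarrow> u = v"
    and spanning: "vec.span S = UNIV"
    and third_class: "\<And>u v. u \<in> S \<Longrightarrow> v \<in> S \<Longrightarrow> cls u \<noteq> cls v \<Longrightarrow>
      \<exists>w\<in>S. cls w \<noteq> cls u \<and> cls w \<noteq> cls v \<and> w \<in> vec.span {u, v}"
    and two_classes: "\<exists>u\<in>S. \<exists>v\<in>S. cls u \<noteq> cls v"
begin

lemma zero_notin: "0 \<notin> S"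
proof
  assume "0 \<in> S"
  then have "v = 0" if "v \<in> S" for v
    using nonproportional[of 0 v] that by (simp add: vec.span_zero)
  then show False using two_classes by metis
qed

section \<open>Counting points outside a subspace\<close>

text \<open>\<open>f u\<close> is a third point on the line joining \<open>p\<close> and
  \<open>u\<close>. It lies off \<open>U\<close>, since otherwise \<open>p\<close> would lie in the
  span of \<open>f u\<close> and \<open>u\<close>, hence in \<open>U\<close>. It determines
  \<open>u\<close>, because a line through \<open>p\<close> meets \<open>U\<close> in at most one
  projective point.\<close>

lemma transversal_map:
  assumes U: "vec.subspace U" and p: "p \<in> S" "p \<notin> U"
  obtains f where "inj_on f {u \<in> S \<inter> U. cls u \<noteq> cls p}"
    "\<And>u. u \<in> S \<inter> U \<Longrightarrow> cls u \<noteq> cls p \<Longrightarrow>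
      f u \<in> S \<inter> vec.span (insert p U) - U \<and> cls (f u) \<noteq> cls p \<and> cls (f u) \<noteq> cls u"
proof -
  have "\<forall>u\<in>{u \<in> S \<inter> U. cls u \<noteq> cls p}. \<exists>w. w \<in> S \<and> cls w \<noteq> cls p \<and> cls w \<noteq> cls u \<and> w \<in> vec.span {p, u}"
  proof
    fix u assume "u \<in> {u \<in> S \<inter> U. cls u \<noteq> cls p}"
    then show "\<exists>w. w \<in> S \<and> cls w \<noteq> cls p \<and> cls w \<noteq> cls u \<and> w \<in> vec.span {p, u}"
      using third_class[OF p(1), of u] by auto
  qed
  from bchoice[OF this] obtain f where f: "\<And>u. u \<in> S \<inter> U \<Longrightarrow> cls u \<noteq> cls p \<Longrightarrow>
      f u \<in> S \<and> cls (f u) \<noteq> cls p \<and> cls (f u) \<noteq> cls u \<and> f u \<in> vec.span {p, u}"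
    by auto
  have offU: "f u \<notin> U" if u: "u \<in> S \<inter> U" "cls u \<noteq> cls p" for u
  proof
    assume "f u \<in> U"
    have "f u \<notin> vec.span {u}"
      using f[OF u] u nonproportional[of "f u" u] by auto
    then have "p \<in> vec.span {f u, u}"
      using f[OF u] vec.in_span_insert[of "f u" p "{u}"] by (simp add: insert_commute)
    moreover have "vec.span {f u, u} \<subseteq> U"
      using \<open>f u \<in> U\<close> u U by (intro vec.span_minimal) auto
    ultimately show False using p by auto
  qed
  have "inj_on f {u \<in> S \<inter> U. cls u \<noteq> cls p}"
  proof (rule inj_onI)
    fix u u' assume *: "u \<in> {u \<in> S \<inter> U. cls u \<noteq> cls p}" "u' \<in> {u \<in> S \<inter> U. cls u \<noteq> cls p}" "f u = f u'"
    obtain k where k: "f u - k *s p \<in> vec.span {u}"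
      using f[of u] * vec.span_breakdown_eq[of "f u" p "{u}"] by auto
    obtain k' where k': "f u - k' *s p \<in> vec.span {u'}"
      using f[of u'] * vec.span_breakdown_eq[of "f u'" p "{u'}"] by auto
    have "vec.span {u} \<subseteq> U" "vec.span {u'} \<subseteq> U"
      using * U by (simp_all add: vec.span_minimal)
    \<comment> \<open>The two decompositions differ by a multiple of \<open>p\<close> inside
      \<open>U\<close>, which must be 0; so \<open>u\<close> and \<open>u'\<close> are
      proportional.\<close>
    with k k' have "(f u - k *s p) - (f u - k' *s p) \<in> U"
      using vec.subspace_diff[OF U] by blast
    moreover have "(f u - k *s p) - (f u - k' *s p) = (k' - k) *s p"
      by (simp add: vec.scale_left_diff_distrib)
    ultimately have kp: "(k' - k) *s p \<in> U" by simp
    have "k' = k"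
    proof (rule ccontr)
      assume "k' \<noteq> k"
      define a where "a = k' - k"
      then have "a \<noteq> 0" using \<open>k' \<noteq> k\<close> by simp
      then have "inverse a *s (a *s p) = p" by simp
      then show False using vec.subspace_scale[OF U kp[folded a_def], of "inverse a"] p by simp
    qed
    obtain a where a: "f u - k *s p = a *s u" using k by (auto simp: vec.span_singleton)
    obtain a' where a': "f u - k *s p = a' *s u'" using k' \<open>k' = k\<close> by (auto simp: vec.span_singleton)
    have "a \<noteq> 0"
    proof
      assume "a = 0"
      then have "f u = k *s p" using a by simp
      then have "f u \<in> vec.span {p}" by (auto simp: vec.span_singleton)
      then show False using f[of u] * nonproportional[of "f u" p] p by auto
    qed
    then have "u = inverse a *s (a *s u)" by simp
    also have "a *s u = a' *s u'" using a a' by simp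
    also have "inverse a *s (a' *s u') = (inverse a * a') *s u'" by simp
    finally have "u \<in> vec.span {u'}" by (auto simp: vec.span_singleton)
    then show "u = u'" using nonproportional * by auto
  qed
  moreover have "f u \<in> vec.span (insert p U)" if "u \<in> S \<inter> U" "cls u \<noteq> cls p" for u
    using f[OF that] that vec.span_mono[of "{p, u}" "insert p U"] by auto
  ultimately show ?thesis using that[of f] f offU by auto
qed

text \<open>A point \<open>p\<close> outside the span would have class \<open>k\<close>. A third
  point on the line from \<open>p\<close> to a point of another class would again lie outside, but
  not in class \<open>k\<close>.\<close>

lemma class_complement_spans: "vec.span {v \<in> S. cls v \<noteq> k} = UNIV"
proof -
  let ?U = "vec.span {v \<in> S. cls v \<noteq> k}"
  have "S \<subseteq> ?U"
  proof
    fix p assume p: "p \<in> S"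
    show "p \<in> ?U"
    proof (rule ccontr)
      assume pU: "p \<notin> ?U"
      then have kp: "cls p = k" using p vec.span_base[of p "{v \<in> S. cls v \<noteq> k}"] by auto
      obtain u where u: "u \<in> S" "cls u \<noteq> k" using two_classes by metis
      then have uU: "u \<in> S \<inter> ?U" by (auto intro: vec.span_base)
      obtain f where f: "\<And>u. u \<in> S \<inter> ?U \<Longrightarrow> cls u \<noteq> cls p \<Longrightarrow>
          f u \<in> S \<inter> vec.span (insert p ?U) - ?U \<and> cls (f u) \<noteq> cls p \<and> cls (f u) \<noteq> cls u"
        using transversal_map[OF vec.subspace_span p pU] by blast
      have "f u \<in> S" "cls (f u) \<noteq> k" "f u \<notin> ?U" using f[OF uU] u kp by auto
      then show False by (auto intro: vec.span_base)
    qed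
  qed
  then have "vec.span S \<subseteq> ?U" by (intro vec.span_minimal) auto
  then show ?thesis using spanning by auto
qed

lemma class_complement_card: "CARD('d) \<le> card {v \<in> S. cls v \<noteq> k}"
proof -
  have "vec.dim (UNIV :: (complex ^ 'd) set) \<le> card {v \<in> S. cls v \<noteq> k}"
    using class_complement_spans[of k] finite_S by (intro vec.dim_le_card) auto
  then show ?thesis by (simp only: vec_dim_card)
qed

text \<open>The points counted form the fibre of \<open>b\<close> under projection from
  \<open>U\<close>, without class \<open>k\<close>. Joining points of \<open>U\<close> to a point of
  the fibre embeds them into the fibre; two such embeddings cover \<open>S \<inter> U\<close>,
  whence the factor 2.\<close>

lemma fibre_card:
  assumes U: "vec.subspace U" and b: "b \<in> S" "b \<notin> U" and u0: "u0 \<in> S \<inter> U" "cls b \<noteq> cls u0"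
  shows "card (S \<inter> U) + 1 \<le> 2 * card {v \<in> S \<inter> vec.span (insert b U) - U. cls v \<noteq> k}"
proof -
  define F where "F = S \<inter> vec.span (insert b U) - U"
  have finF: "finite F" and finU: "finite (S \<inter> U)" using finite_S by (auto simp: F_def)
  \<comment> \<open>Every \<open>p\<close> in the fibre generates the same fibre, so
    \<open>transversal_map\<close> may start from any of them.\<close>
  have Fp: "S \<inter> vec.span (insert p U) - U = F" if "p \<in> F" for p
  proof -
    have p: "p \<in> vec.span (insert b U)" "p \<notin> U" using that by (auto simp: F_def)
    then have "b \<in> vec.span (insert p U)"
      using vec.in_span_insert[of p b U] U by (simp add: vec.span_eq_iff[THEN iffD2])
    moreover have "U \<subseteq> vec.span (insert q U)" for q
      using vec.span_superset[of "insert q U"] by auto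
    ultimately have "vec.span (insert b U) = vec.span (insert p U)"
      using p by (auto simp: vec.span_eq)
    then show ?thesis by (simp add: F_def)
  qed
  have map: "\<exists>f. inj_on f {u \<in> S \<inter> U. cls u \<noteq> cls p} \<and>
      (\<forall>u\<in>S \<inter> U. cls u \<noteq> cls p \<longrightarrow> f u \<in> F \<and> cls (f u) \<noteq> cls p \<and> cls (f u) \<noteq> cls u)" if "p \<in> F" for p
  proof -
    have "p \<in> S" "p \<notin> U" using that by (auto simp: F_def)
    then obtain f where "inj_on f {u \<in> S \<inter> U. cls u \<noteq> cls p}"
      "\<And>u. u \<in> S \<inter> U \<Longrightarrow> cls u \<noteq> cls p \<Longrightarrow>
        f u \<in> S \<inter> vec.span (insert p U) - U \<and> cls (f u) \<noteq> cls p \<and> cls (f u) \<noteq> cls u"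
      using transversal_map[OF U] by blast
    then show ?thesis unfolding Fp[OF that] by blast
  qed
  have same: "card {u \<in> S \<inter> U. cls u \<noteq> cls p} \<le> card {v \<in> F. cls v \<noteq> cls p}" if p: "p \<in> F" for p
  proof -
    obtain f where "inj_on f {u \<in> S \<inter> U. cls u \<noteq> cls p}"
      "\<forall>u\<in>S \<inter> U. cls u \<noteq> cls p \<longrightarrow> f u \<in> F \<and> cls (f u) \<noteq> cls p \<and> cls (f u) \<noteq> cls u"
      using map[OF p] by blast
    then show ?thesis using finF by (intro card_inj_on_le[of f]) auto
  qed
  \<comment> \<open>The images have neither class \<open>k\<close>, the class of \<open>u\<close>,
    nor the class of \<open>p\<close>. So they also miss \<open>p\<close> itself, which gives the
    extra 1.\<close>
  have other: "card {u \<in> S \<inter> U. cls u = k} + 1 \<le> card {v \<in> F. cls v \<noteq> k}" if p: "p \<in> F" "cls p \<noteq> k" for p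
  proof -
    obtain f where f: "inj_on f {u \<in> S \<inter> U. cls u \<noteq> cls p}"
      "\<forall>u\<in>S \<inter> U. cls u \<noteq> cls p \<longrightarrow> f u \<in> F \<and> cls (f u) \<noteq> cls p \<and> cls (f u) \<noteq> cls u"
      using map[OF p(1)] by blast
    have "card {u \<in> S \<inter> U. cls u = k} \<le> card ({v \<in> F. cls v \<noteq> k} - {p})"
    proof (rule card_inj_on_le[of f])
      show "inj_on f {u \<in> S \<inter> U. cls u = k}"
        using p by (intro inj_on_subset[OF f(1)]) auto
      show "f ` {u \<in> S \<inter> U. cls u = k} \<subseteq> {v \<in> F. cls v \<noteq> k} - {p}"
      proof
        fix x assume "x \<in> f ` {u \<in> S \<inter> U. cls u = k}"
        then obtain u where u: "u \<in> S \<inter> U" "cls u = k" "x = f u" by auto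
        then show "x \<in> {v \<in> F. cls v \<noteq> k} - {p}"
          using bspec[OF f(2) u(1)] p by auto
      qed
    qed (use finF in auto)
    also have "card ({v \<in> F. cls v \<noteq> k} - {p}) + 1 = card {v \<in> F. cls v \<noteq> k}"
      using p finF card_Suc_Diff1[of "{v \<in> F. cls v \<noteq> k}" p] by (simp del: card_Diff_insert)
    finally show ?thesis by simp
  qed
  have bF: "b \<in> F" using b by (auto simp: F_def intro: vec.span_base)
  obtain w where w: "w \<in> F" "cls w \<noteq> cls b"
    using map[OF bF] u0 by metis
  show ?thesis
  proof (cases "\<exists>x\<in>F. cls x = k")
    \<comment> \<open>The points of \<open>U\<close> outside class \<open>k\<close> are embedded
      through \<open>x\<close>, those of class \<open>k\<close> through \<open>y\<close>.\<close>
    case True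
    then obtain x where x: "x \<in> F" "cls x = k" by blast
    obtain y where y: "y \<in> F" "cls y \<noteq> k" using bF w by metis
    have "card {u \<in> S \<inter> U. cls u \<noteq> k} \<le> card {v \<in> F. cls v \<noteq> k}"
      using same[OF x(1)] x(2) by simp
    moreover have "card (S \<inter> U) = card {u \<in> S \<inter> U. cls u \<noteq> k} + card {u \<in> S \<inter> U. cls u = k}"
      using finite_S by (subst card_Un_disjoint[symmetric]) (auto intro!: arg_cong[where f = card])
    ultimately show ?thesis using other[OF y] by (simp add: F_def)
  next
    \<comment> \<open>Every point of \<open>U\<close> differs in class from \<open>b\<close> or from
      \<open>w\<close>, and each of the two embeddings misses its own base point.\<close>
    case False
    have "card {v \<in> F. cls v \<noteq> cls p} + 1 \<le> card F" if "p \<in> F" for p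
    proof -
      have "card {v \<in> F. cls v \<noteq> cls p} < card F"
        using that finF by (intro psubset_card_mono) auto
      then show ?thesis by simp
    qed
    note * = this[OF bF] this[OF w(1)] same[OF bF] same[OF w(1)]
    have "card (S \<inter> U) \<le> card ({u \<in> S \<inter> U. cls u \<noteq> cls b} \<union> {u \<in> S \<inter> U. cls u \<noteq> cls w})"
      using finite_S w(2) by (intro card_mono) auto
    also have "\<dots> \<le> card {u \<in> S \<inter> U. cls u \<noteq> cls b} + card {u \<in> S \<inter> U. cls u \<noteq> cls w}"
      by (rule card_Un_le)
    finally have "card (S \<inter> U) + 1 \<le> 2 * card F" using * by simp
    moreover have "{v \<in> F. cls v \<noteq> k} = F" using False by auto
    ultimately show ?thesis by (simp add: F_def)
  qed
qed

text \<open>A basis of \<open>vec.span X\<close> is completed to one of the whole space. The fibres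
  of the added vectors under projection from \<open>vec.span X\<close> are disjoint, and
  \<open>fibre_card\<close> applies to each.\<close>

lemma transversal_points_bound:
  assumes X: "X \<subseteq> S" "X \<noteq> {}"
  shows "(CARD('d) - vec.dim X) * (card (S \<inter> vec.span X) + 1) \<le> 2 * card {v \<in> S - vec.span X. cls v \<noteq> k}"
proof -
  let ?U = "vec.span X"
  obtain u0 where u0: "u0 \<in> X" using X by blast
  obtain Bu where Bu: "Bu \<subseteq> X" "vec.independent Bu" "X \<subseteq> vec.span Bu" "card Bu = vec.dim X"
    using vec.basis_exists[of X] by blast
  have spanBu: "vec.span Bu = ?U"
    using Bu by (metis vec.span_mono vec.span_span subset_antisym)
  \<comment> \<open>Only points outside the class of \<open>u0\<close> are added: they suffice by
    \<open>class_complement_spans\<close> and satisfy the class condition of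
    \<open>fibre_card\<close>.\<close>
  obtain B where B: "Bu \<subseteq> B" "B \<subseteq> Bu \<union> {v \<in> S. cls v \<noteq> cls u0}" "vec.independent B"
      "Bu \<union> {v \<in> S. cls v \<noteq> cls u0} \<subseteq> vec.span B"
    using vec.maximal_independent_subset_extend[of Bu "Bu \<union> {v \<in> S. cls v \<noteq> cls u0}"] Bu(2) by auto
  have "vec.span {v \<in> S. cls v \<noteq> cls u0} \<subseteq> vec.span B"
    using B(4) by (intro vec.span_minimal) auto
  then have "vec.span B = UNIV" using class_complement_spans by auto
  then have "card B = vec.dim (UNIV :: (complex ^ 'd) set)"
    using vec.dim_span_eq_card_independent[OF B(3)] by simp
  then have cardB: "card B = CARD('d)" by (simp only: vec_dim_card)
  have finB: "finite B" using B(3) by (rule vec.finiteI_independent)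
  have cardD: "card (B - Bu) = CARD('d) - vec.dim X"
    using B(1) finB Bu(4) cardB by (simp add: card_Diff_subset finite_subset)
  define F where "F b = {v \<in> S \<inter> vec.span (insert b ?U) - ?U. cls v \<noteq> k}" for b
  have notU: "b \<notin> vec.span (B - {b})" if "b \<in> B" for b
    using B(3) that by (auto simp: vec.dependent_def)
  have UB: "?U \<subseteq> vec.span (B - {b})" if "b \<in> B - Bu" for b
    unfolding spanBu[symmetric] using that B(1) by (intro vec.span_mono) auto
  \<comment> \<open>A common point of two fibres would put \<open>b\<close> into the span of the
    other basis vectors.\<close>
  have disj: "F b \<inter> F b' = {}" if bb: "b \<in> B - Bu" "b' \<in> B - Bu" "b \<noteq> b'" for b b'
  proof (rule ccontr)
    assume "F b \<inter> F b' \<noteq> {}"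
    then obtain x where x: "x \<in> vec.span (insert b ?U)" "x \<notin> ?U" "x \<in> vec.span (insert b' ?U)"
      by (auto simp: F_def)
    have "b \<in> vec.span (insert x ?U)"
      using vec.in_span_insert[OF x(1)] x(2) by (simp add: vec.span_span)
    moreover have "vec.span (insert x ?U) \<subseteq> vec.span (B - {b})"
    proof (rule vec.span_minimal)
      have "vec.span (insert b' ?U) \<subseteq> vec.span (B - {b})"
        using UB[OF bb(1)] bb by (intro vec.span_minimal) (auto intro: vec.span_base)
      then show "insert x ?U \<subseteq> vec.span (B - {b})" using x(3) UB[OF bb(1)] by auto
    qed simp
    ultimately show False using notU[of b] bb by auto
  qed
  have "(\<Sum>b\<in>B - Bu. card (S \<inter> ?U) + 1) \<le> (\<Sum>b\<in>B - Bu. 2 * card (F b))"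
  proof (rule sum_mono)
    fix b assume b: "b \<in> B - Bu"
    then have "b \<in> S" "cls b \<noteq> cls u0" using B(2) by auto
    moreover have "b \<notin> ?U" using UB[OF b] notU[of b] b by auto
    moreover have "u0 \<in> S \<inter> ?U" using u0 X by (auto intro: vec.span_base)
    ultimately show "card (S \<inter> ?U) + 1 \<le> 2 * card (F b)"
      unfolding F_def by (intro fibre_card) auto
  qed
  also have "\<dots> = 2 * card (\<Union>b\<in>B - Bu. F b)"
    using finB finite_S disj
    by (subst card_UN_disjoint) (auto simp: sum_distrib_left F_def)
  also have "card (\<Union>b\<in>B - Bu. F b) \<le> card {v \<in> S - ?U. cls v \<noteq> k}"
    using finite_S by (intro card_mono) (auto simp: F_def)
  finally show ?thesis by (simp add: cardD)
qed

section \<open>Stability of the class weights\<close>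

definition weight :: "'c \<Rightarrow> real \<Rightarrow> complex ^ 'd \<Rightarrow> real"
  where "weight k \<omega> v = (if cls v = k then \<omega> else 1)"

text \<open>This supplies the stability hypothesis of \<open>exists_tight_frame\<close>. For a
  single point it says that the total weight exceeds the dimension; for larger subspaces it follows
  from \<open>transversal_points_bound\<close>, as weights are at most 1 and equal to 1 off class
  \<open>k\<close>.\<close>

lemma weights_stable:
  assumes \<omega>: "0 < \<omega>" "\<omega> \<le> 1" and k: "\<exists>v\<in>S. cls v = k"
    and X: "X \<subseteq> S" "X \<noteq> {}" "vec.span X \<noteq> UNIV"
  shows "(\<Sum>v\<in>S \<inter> vec.span X. weight k \<omega> v) < (\<Sum>v\<in>S. weight k \<omega> v) / CARD('d) * vec.dim X"
proof -
  let ?U = "vec.span X"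
  define C where "C = (\<Sum>v\<in>S \<inter> ?U. weight k \<omega> v)"
  define W where "W = (\<Sum>v\<in>S. weight k \<omega> v)"
  define e where "e = vec.dim X"
  have wle: "weight k \<omega> v \<le> 1" "weight k \<omega> v > 0" for v using \<omega> by (auto simp: weight_def)
  have C: "C \<le> card (S \<inter> ?U)" "0 \<le> C"
    using sum_bounded_above[of "S \<inter> ?U" "weight k \<omega>" 1] wle
    by (auto simp: C_def less_imp_le intro!: sum_nonneg)
  have outside: "W \<ge> C + card {v \<in> S - ?U. cls v \<noteq> k}"
  proof -
    have "W = C + (\<Sum>v\<in>S - ?U. weight k \<omega> v)"
      unfolding W_def C_def using finite_S by (rule sum.Int_Diff)
    moreover have "(\<Sum>v\<in>{v \<in> S - ?U. cls v \<noteq> k}. weight k \<omega> v) \<le> (\<Sum>v\<in>S - ?U. weight k \<omega> v)"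
      using finite_S wle by (intro sum_mono2) (auto simp: less_imp_le)
    moreover have "(\<Sum>v\<in>{v \<in> S - ?U. cls v \<noteq> k}. weight k \<omega> v) = card {v \<in> S - ?U. cls v \<noteq> k}"
      by (simp add: weight_def)
    ultimately show ?thesis by simp
  qed
  have elt: "e < CARD('d)"
  proof -
    have "vec.span X \<subset> vec.span UNIV" using X by auto
    then have "vec.dim X < vec.dim (UNIV :: (complex ^ 'd) set)" by (rule vec.dim_psubset)
    then show ?thesis by (simp only: vec_dim_card e_def)
  qed
  have epos: "e > 0"
    using X zero_notin by (auto simp: e_def simp del: neq0_conv simp flip: neq0_conv)
  have "C * CARD('d) < W * e"
  proof (cases "e = 1")
    case True
    obtain v0 where v0: "v0 \<in> X" using X by blast
    have "S \<inter> ?U \<subseteq> {v0}"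
    proof
      fix v assume v: "v \<in> S \<inter> ?U"
      have "v0 \<noteq> 0" using v0 X zero_notin by auto
      then have "X \<subseteq> vec.span {v0}"
        using v0 True by (intro vec.card_ge_dim_independent) (auto simp: e_def)
      then have "?U \<subseteq> vec.span {v0}" by (intro vec.span_minimal) auto
      then show "v \<in> {v0}" using v nonproportional[of v v0] v0 X by auto
    qed
    then have "C \<le> 1" using C card_mono[of "{v0}" "S \<inter> ?U"] by simp
    \<comment> \<open>The points off class \<open>k\<close> already weigh at least
      \<open>CARD('d)\<close>, and class \<open>k\<close> adds a positive amount.\<close>
    moreover have "CARD('d) < W"
    proof -
      obtain v where v: "v \<in> S" "cls v = k" using k by blast
      have "(\<Sum>v\<in>{v \<in> S. cls v \<noteq> k}. weight k \<omega> v) < W"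
        unfolding W_def using finite_S v wle by (intro sum_strict_mono2[of _ _ v]) (auto simp: less_imp_le)
      moreover have "(\<Sum>v\<in>{v \<in> S. cls v \<noteq> k}. weight k \<omega> v) = card {v \<in> S. cls v \<noteq> k}"
        by (simp add: weight_def)
      ultimately show ?thesis using class_complement_card[of k] by simp
    qed
    ultimately have "C * CARD('d) < W"
      using mult_right_mono[of C 1 "CARD('d)"] by linarith
    then show ?thesis using True by simp
  next
    case False
    then have e2: "real e \<ge> 2" using epos by simp
    define g where "g = real CARD('d) - e"
    have g: "g > 0" using elt by (simp add: g_def)
    have "real ((CARD('d) - e) * (card (S \<inter> ?U) + 1)) \<le> real (2 * card {v \<in> S - ?U. cls v \<noteq> k})"
      using transversal_points_bound[OF X(1,2), of k] unfolding e_def of_nat_le_iff .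
    moreover have "real (CARD('d) - e) = g" using elt by (simp add: g_def of_nat_diff)
    ultimately have "g * (card (S \<inter> ?U) + 1) \<le> 2 * card {v \<in> S - ?U. cls v \<noteq> k}"
      unfolding of_nat_mult by simp
    moreover have "g * (C + 1) \<le> g * (card (S \<inter> ?U) + 1)" using g C by simp
    ultimately have "2 * C + g * (C + 1) \<le> 2 * W" using outside by simp
    then have "(2 + g) * C < 2 * W" using g by (simp add: algebra_simps)
    then have "(2 + g) * C * e < 2 * W * e" using e2 by simp
    \<comment> \<open>Here \<open>e \<ge> 2\<close> matters:
      \<open>(2 + g) * e - 2 * (g + e)\<close> equals \<open>(e - 2) * g\<close>.\<close>
    moreover have "2 * (C * CARD('d)) \<le> (2 + g) * C * e"
    proof -
      have "0 \<le> C * ((real e - 2) * g)" using C e2 g by (intro mult_nonneg_nonneg) auto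
      moreover have "CARD('d) = g + e" by (simp add: g_def)
      ultimately show ?thesis by (simp add: algebra_simps)
    qed
    ultimately show ?thesis by simp
  qed
  then show ?thesis
    by (simp add: C_def W_def e_def field_simps)
qed

end

section \<open>Frame potentials\<close>

text \<open>The complex-valued inner product; \<open>inner\<close> on \<open>complex ^ 'd\<close> is
  its real part.\<close>

definition hermitian :: "complex ^ 'd \<Rightarrow> complex ^ 'd \<Rightarrow> complex"
  where "hermitian x y = (\<Sum>i\<in>UNIV. x $ i * cnj (y $ i))"

lemma hermitian_add_left: "hermitian (x + y) z = hermitian x z + hermitian y z"
  by (simp add: hermitian_def distrib_right sum.distrib)

lemma hermitian_add_right: "hermitian x (y + z) = hermitian x y + hermitian x z"
  by (simp add: hermitian_def distrib_left sum.distrib)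

lemma hermitian_scale_left: "hermitian (a *s x) y = a * hermitian x y"
  by (simp add: hermitian_def sum_distrib_left mult_ac)

lemma hermitian_scale_right: "hermitian x (a *s y) = cnj a * hermitian x y"
  by (simp add: hermitian_def sum_distrib_left mult_ac)

lemma hermitian_cnj: "cnj (hermitian x y) = hermitian y x"
  by (simp add: hermitian_def mult_ac)

lemma norm_square_sum: "(norm (x :: complex ^ 'd))\<^sup>2 = (\<Sum>i\<in>UNIV. (cmod (x $ i))\<^sup>2)"
  by (simp add: norm_vec_def L2_set_def sum_nonneg)

lemma hermitian_self: "hermitian x x = of_real ((norm x)\<^sup>2)"
  by (simp only: norm_square_sum hermitian_def complex_norm_square of_real_sum)

lemma hermitian_bound: "cmod (hermitian x y) \<le> norm x * norm y"
proof -
  have "cmod (hermitian x y) \<le> (\<Sum>i\<in>UNIV. cmod (x $ i) * cmod (y $ i))"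
    unfolding hermitian_def by (rule sum_norm_le) (simp add: norm_mult)
  also have "\<dots> \<le> norm x * norm y"
    using L2_set_mult_ineq[of "\<lambda>i. cmod (x $ i)" "\<lambda>i. cmod (y $ i)" UNIV] by (simp add: norm_vec_def)
  finally show ?thesis .
qed

text \<open>Both sides expand into the same fourfold sum. The right-hand side is the squared
  Hilbert-Schmidt norm of the frame operator, so a tight frame makes the left-hand side
  computable.\<close>

lemma frame_potential_eq:
  fixes a :: "'v \<Rightarrow> 'i \<Rightarrow> complex" and c :: "'v \<Rightarrow> real"
  shows "(\<Sum>u\<in>B. \<Sum>v\<in>B. c u * c v * (cmod (\<Sum>i\<in>I. a u i * cnj (a v i)))\<^sup>2)
       = (\<Sum>i\<in>I. \<Sum>j\<in>I. (cmod (\<Sum>v\<in>B. of_real (c v) * (a v i * cnj (a v j))))\<^sup>2)"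
proof -
  define g where "g u v i j = of_real (c u) * of_real (c v) * (a u i * cnj (a v i) * (cnj (a u j) * a v j))" for u v i j
  have l: "of_real (c u * c v * (cmod (\<Sum>i\<in>I. a u i * cnj (a v i)))\<^sup>2) = (\<Sum>i\<in>I. \<Sum>j\<in>I. g u v i j)" for u v
    by (simp only: of_real_mult complex_norm_square cnj_sum sum_product)
      (simp add: g_def sum_distrib_left)
  have r: "of_real ((cmod (\<Sum>v\<in>B. of_real (c v) * (a v i * cnj (a v j))))\<^sup>2) = (\<Sum>u\<in>B. \<Sum>v\<in>B. g u v i j)" for i j
    by (simp only: complex_norm_square cnj_sum sum_product) (simp add: g_def mult_ac)
  have "(\<Sum>u\<in>B. \<Sum>v\<in>B. \<Sum>i\<in>I. \<Sum>j\<in>I. g u v i j) = (\<Sum>u\<in>B. \<Sum>i\<in>I. \<Sum>v\<in>B. \<Sum>j\<in>I. g u v i j)"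
    by (intro sum.cong refl sum.swap)
  also have "\<dots> = (\<Sum>i\<in>I. \<Sum>u\<in>B. \<Sum>v\<in>B. \<Sum>j\<in>I. g u v i j)"
    by (rule sum.swap)
  also have "\<dots> = (\<Sum>i\<in>I. \<Sum>u\<in>B. \<Sum>j\<in>I. \<Sum>v\<in>B. g u v i j)"
    by (intro sum.cong refl sum.swap)
  also have "\<dots> = (\<Sum>i\<in>I. \<Sum>j\<in>I. \<Sum>u\<in>B. \<Sum>v\<in>B. g u v i j)"
    by (intro sum.cong refl sum.swap)
  finally show ?thesis
    unfolding l[symmetric] r[symmetric] of_real_sum[symmetric] of_real_eq_iff .
qed

text \<open>A Welch bound: the trace of the frame operator is the total weight, and Cauchy-Schwarz
  on the diagonal compares it with the Hilbert-Schmidt norm.\<close>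

lemma frame_potential_ge:
  fixes a :: "'v \<Rightarrow> 'i \<Rightarrow> complex" and c :: "'v \<Rightarrow> real"
  assumes unit: "\<And>v. v \<in> B \<Longrightarrow> (\<Sum>i\<in>I. (cmod (a v i))\<^sup>2) = 1"
  shows "(\<Sum>v\<in>B. c v)\<^sup>2 \<le> card I * (\<Sum>u\<in>B. \<Sum>v\<in>B. c u * c v * (cmod (\<Sum>i\<in>I. a u i * cnj (a v i)))\<^sup>2)"
proof (cases "finite I")
  case True
  define F where "F i j = (\<Sum>v\<in>B. of_real (c v) * (a v i * cnj (a v j)))" for i j
  have F: "F i i = of_real (\<Sum>v\<in>B. c v * (cmod (a v i))\<^sup>2)" for i
    by (simp add: F_def complex_norm_square[symmetric])
  have "(\<Sum>v\<in>B. c v) = (\<Sum>v\<in>B. \<Sum>i\<in>I. c v * (cmod (a v i))\<^sup>2)"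
    using unit by (simp add: sum_distrib_left[symmetric])
  also have "\<dots> = (\<Sum>i\<in>I. \<Sum>v\<in>B. c v * (cmod (a v i))\<^sup>2)" by (rule sum.swap)
  finally have "(\<Sum>v\<in>B. c v)\<^sup>2 = (\<Sum>i\<in>I. 1 * (\<Sum>v\<in>B. c v * (cmod (a v i))\<^sup>2))\<^sup>2" by simp
  also have "\<dots> \<le> (\<Sum>i\<in>I. 1\<^sup>2) * (\<Sum>i\<in>I. (\<Sum>v\<in>B. c v * (cmod (a v i))\<^sup>2)\<^sup>2)"
    by (rule Cauchy_Schwarz_ineq_sum)
  also have "\<dots> = card I * (\<Sum>i\<in>I. (cmod (F i i))\<^sup>2)"
    unfolding F norm_of_real by simp
  also have "\<dots> \<le> card I * (\<Sum>i\<in>I. \<Sum>j\<in>I. (cmod (F i j))\<^sup>2)"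
    using True by (intro mult_left_mono sum_mono member_le_sum) auto
  finally show ?thesis
    by (simp add: frame_potential_eq F_def)
next
  \<comment> \<open>Sums over infinite \<open>I\<close> are 0, which contradicts \<open>unit\<close>
    unless \<open>B\<close> is empty.\<close>
  case False
  then have "B = {}" using unit by auto
  then show ?thesis by simp
qed

lemma frame_potential_space:
  fixes e :: "'v \<Rightarrow> complex ^ 'd"
  assumes "\<And>v. v \<in> B \<Longrightarrow> norm (e v) = 1"
  shows "(\<Sum>v\<in>B. c v)\<^sup>2 \<le> CARD('d) * (\<Sum>u\<in>B. \<Sum>v\<in>B. c u * c v * (cmod (hermitian (e u) (e v)))\<^sup>2)"
  unfolding hermitian_def
  by (rule frame_potential_ge) (simp add: assms flip: norm_square_sum)

text \<open>Gram-Schmidt replaces \<open>q\<close> by a vector orthogonal to \<open>p\<close>; the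
  plane then has two coordinates, indexed by \<open>bool\<close>, and the Welch bound applies with
  constant 2.\<close>

lemma frame_potential_plane:
  fixes e :: "'v \<Rightarrow> complex ^ 'd"
  assumes unit: "\<And>v. v \<in> B \<Longrightarrow> norm (e v) = 1" and p: "norm p = 1"
    and plane: "\<And>v. v \<in> B \<Longrightarrow> \<exists>\<alpha> \<beta>. e v = \<alpha> *s p + \<beta> *s q"
  shows "(\<Sum>v\<in>B. c v)\<^sup>2 \<le> 2 * (\<Sum>u\<in>B. \<Sum>v\<in>B. c u * c v * (cmod (hermitian (e u) (e v)))\<^sup>2)"
proof -
  define r where "r = q + (- hermitian q p) *s p"
  have pp: "hermitian p p = 1" using p by (simp add: hermitian_self)
  have rp: "hermitian r p = 0"
    unfolding r_def by (simp only: hermitian_add_left hermitian_scale_left pp) simp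
  have pr: "hermitian p r = 0"
    using hermitian_cnj[of r p] rp by simp
  have "\<exists>\<alpha> \<beta>. e v = \<alpha> *s p + \<beta> *s r" if v: "v \<in> B" for v
  proof -
    obtain \<alpha> \<beta> where "e v = \<alpha> *s p + \<beta> *s q" using plane[OF v] by blast
    then have "e v = (\<alpha> + \<beta> * hermitian q p) *s p + \<beta> *s r"
      by (simp add: r_def vec.scale_right_distrib vec.scale_left_distrib)
    then show ?thesis by blast
  qed
  then obtain \<alpha> \<beta> where e: "\<And>v. v \<in> B \<Longrightarrow> e v = \<alpha> v *s p + \<beta> v *s r" by metis
  \<comment> \<open>The factor \<open>norm r\<close> keeps the coordinates valid when
    \<open>r\<close> vanishes, that is when \<open>q\<close> is a multiple of
    \<open>p\<close>.\<close>
  define a where "a v b = (if b then \<alpha> v else of_real (norm r) * \<beta> v)" for v b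
  have h: "hermitian (e u) (e v) = (\<Sum>b\<in>UNIV. a u b * cnj (a v b))" if "u \<in> B" "v \<in> B" for u v
  proof -
    have "hermitian (e u) (e v) = \<alpha> u * cnj (\<alpha> v) + \<beta> u * cnj (\<beta> v) * of_real ((norm r)\<^sup>2)"
      using e[OF that(1)] e[OF that(2)]
      by (simp only: hermitian_add_left hermitian_add_right hermitian_scale_left hermitian_scale_right
          pp rp pr hermitian_self[of r]) simp
    then show ?thesis by (simp add: a_def UNIV_bool power2_eq_square)
  qed
  have "(\<Sum>v\<in>B. c v)\<^sup>2 \<le> card (UNIV :: bool set) * (\<Sum>u\<in>B. \<Sum>v\<in>B. c u * c v * (cmod (\<Sum>b\<in>UNIV. a u b * cnj (a v b)))\<^sup>2)"
  proof (rule frame_potential_ge)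
    fix v assume v: "v \<in> B"
    have "complex_of_real (\<Sum>b\<in>UNIV. (cmod (a v b))\<^sup>2) = hermitian (e v) (e v)"
      unfolding h[OF v v] of_real_sum complex_norm_square ..
    also have "\<dots> = of_real 1" using unit[OF v] by (simp add: hermitian_self)
    finally show "(\<Sum>b\<in>UNIV. (cmod (a v b))\<^sup>2) = 1" unfolding of_real_eq_iff .
  qed
  also have "\<dots> = 2 * (\<Sum>u\<in>B. \<Sum>v\<in>B. c u * c v * (cmod (hermitian (e u) (e v)))\<^sup>2)"
    using h by (simp cong: sum.cong)
  finally show ?thesis .
qed

section \<open>Incidences of points and lines\<close>

context coloured_configuration
begin

definition lines :: "(complex ^ 'd) set set"
  where "lines = {S \<inter> vec.span {u, v} | u v. u \<in> S \<and> v \<in> S \<and> cls u \<noteq> cls v}"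

lemma line_subset: "l \<in> lines \<Longrightarrow> l \<subseteq> S"
  by (auto simp: lines_def)

lemma finite_lines: "finite lines"
proof -
  have "lines \<subseteq> Pow S" using line_subset by auto
  then show ?thesis using finite_S finite_subset by blast
qed

text \<open>Distinct points of \<open>S\<close> are linearly independent, so two of them already
  span the at most two-dimensional space generated by the pair defining \<open>l\<close>.\<close>

lemma line_eq:
  assumes "l \<in> lines" "x \<in> l" "y \<in> l" "x \<noteq> y"
  shows "l = S \<inter> vec.span {x, y}"
proof -
  obtain u v where l: "l = S \<inter> vec.span {u, v}" using assms(1) by (auto simp: lines_def)
  have S: "x \<in> S" "y \<in> S" and xy: "{x, y} \<subseteq> vec.span {u, v}" using assms l by auto
  have "x \<notin> vec.span {y}" using nonproportional S assms(4) by auto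
  moreover have "y \<noteq> 0" using S zero_notin by metis
  ultimately have ind: "vec.independent {x, y}"
    using vec.independent_insertI[of x "{y}"] by simp
  have "vec.dim (vec.span {u, v}) \<le> card {u, v}" by (rule vec.dim_le_card) auto
  also have "\<dots> \<le> 2" by (simp add: card_insert_if)
  also have "\<dots> = card {x, y}" using assms(4) by simp
  finally have "vec.span {u, v} \<subseteq> vec.span {x, y}"
    by (intro vec.card_ge_dim_independent[OF xy ind])
  moreover have "vec.span {x, y} \<subseteq> vec.span {u, v}" using xy by (intro vec.span_minimal) auto
  ultimately show ?thesis using l by auto
qed

text \<open>One of the two points defining the line has another class than \<open>v\<close>;
  together with \<open>v\<close> it spans the same line, where \<open>third_class\<close> gives the
  other point.\<close>

lemma line_two_more_classes:
  assumes "l \<in> lines" "v \<in> l"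
  obtains y w where "y \<in> l" "w \<in> l" "cls y \<noteq> cls v" "cls w \<noteq> cls v" "cls w \<noteq> cls y"
proof -
  obtain a b where l: "l = S \<inter> vec.span {a, b}" "a \<in> S" "b \<in> S" "cls a \<noteq> cls b"
    using assms(1) by (auto simp: lines_def)
  then have "a \<in> l" "b \<in> l" by (auto intro: vec.span_base)
  then obtain y where y: "y \<in> l" "cls y \<noteq> cls v" using l(4) by metis
  have "v \<in> S" "y \<in> S" using assms y l by auto
  then obtain w where w: "w \<in> S" "cls w \<noteq> cls v" "cls w \<noteq> cls y" "w \<in> vec.span {v, y}"
    using third_class[of v y] y by metis
  have "l = S \<inter> vec.span {v, y}" using line_eq[OF assms y(1)] y(2) by auto
  then show thesis using that[OF y(1) _ y(2)] w by blast
qed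

definition deg :: "complex ^ 'd \<Rightarrow> nat"
  where "deg v = card {l \<in> lines. v \<in> l}"

text \<open>Two lines through \<open>v\<close> share no other point, so their traces on
  \<open>Y\<close> are disjoint.\<close>

lemma sum_card_lines_through:
  assumes "Y \<subseteq> S" "v \<notin> Y"
  shows "(\<Sum>l | l \<in> lines \<and> v \<in> l. card (l \<inter> Y)) \<le> card Y"
proof -
  have "finite Y" using assms finite_S finite_subset by blast
  have "(\<Sum>l | l \<in> lines \<and> v \<in> l. card (l \<inter> Y)) = card (\<Union>l\<in>{l \<in> lines. v \<in> l}. l \<inter> Y)"
  proof (rule card_UN_disjoint[symmetric])
    show "\<forall>l\<in>{l \<in> lines. v \<in> l}. \<forall>l'\<in>{l \<in> lines. v \<in> l}. l \<noteq> l' \<longrightarrow> l \<inter> Y \<inter> (l' \<inter> Y) = {}"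
    proof (intro ballI impI, rule ccontr)
      fix l l' assume *: "l \<in> {l \<in> lines. v \<in> l}" "l' \<in> {l \<in> lines. v \<in> l}" "l \<noteq> l'"
        "l \<inter> Y \<inter> (l' \<inter> Y) \<noteq> {}"
      then obtain x where "x \<in> l" "x \<in> l'" "x \<in> Y" by auto
      then have "l = S \<inter> vec.span {v, x}" "l' = S \<inter> vec.span {v, x}"
        using line_eq[of l v x] line_eq[of l' v x] * assms(2) by auto
      then show False using * by simp
    qed
  qed (use \<open>finite Y\<close> finite_lines in auto)
  also have "\<dots> \<le> card Y" using \<open>finite Y\<close> by (intro card_mono) auto
  finally show ?thesis .
qed

lemma two_deg_le:
  assumes "v \<in> S"
  shows "2 * deg v \<le> card {y \<in> S. cls y \<noteq> cls v}"
proof -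
  have "(\<Sum>l | l \<in> lines \<and> v \<in> l. 2) \<le> (\<Sum>l | l \<in> lines \<and> v \<in> l. card (l \<inter> {y \<in> S. cls y \<noteq> cls v}))"
  proof (rule sum_mono)
    fix l assume "l \<in> {l. l \<in> lines \<and> v \<in> l}"
    then have l: "l \<in> lines" "v \<in> l" by auto
    obtain y w where *: "y \<in> l" "w \<in> l" "cls y \<noteq> cls v" "cls w \<noteq> cls v" "cls w \<noteq> cls y"
      using line_two_more_classes[OF l] .
    have "card {y, w} \<le> card (l \<inter> {y \<in> S. cls y \<noteq> cls v})"
      using * line_subset[OF l(1)] finite_S by (intro card_mono) auto
    moreover have "card {y, w} = 2" using *(5) by (cases "y = w") auto
    ultimately show "2 \<le> card (l \<inter> {y \<in> S. cls y \<noteq> cls v})" by simp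
  qed
  also have "\<dots> \<le> card {y \<in> S. cls y \<noteq> cls v}"
    by (rule sum_card_lines_through) auto
  finally show ?thesis by (simp add: deg_def)
qed

text \<open>Of the two further classes on a line through \<open>v\<close>, at most one is
  \<open>k\<close>. This beats \<open>two_deg_le\<close> when class \<open>k\<close> is
  large.\<close>

lemma deg_le:
  assumes "v \<in> S"
  shows "deg v \<le> card {y \<in> S. cls y \<noteq> cls v \<and> cls y \<noteq> k}"
proof -
  have "(\<Sum>l | l \<in> lines \<and> v \<in> l. 1) \<le> (\<Sum>l | l \<in> lines \<and> v \<in> l. card (l \<inter> {y \<in> S. cls y \<noteq> cls v \<and> cls y \<noteq> k}))"
  proof (rule sum_mono)
    fix l assume "l \<in> {l. l \<in> lines \<and> v \<in> l}"
    then have l: "l \<in> lines" "v \<in> l" by auto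
    obtain y w where *: "y \<in> l" "w \<in> l" "cls y \<noteq> cls v" "cls w \<noteq> cls v" "cls w \<noteq> cls y"
      using line_two_more_classes[OF l] .
    then have "l \<inter> {y \<in> S. cls y \<noteq> cls v \<and> cls y \<noteq> k} \<noteq> {}"
      using line_subset[OF l(1)] by (cases "cls y = k") auto
    moreover have "finite (l \<inter> {y \<in> S. cls y \<noteq> cls v \<and> cls y \<noteq> k})" using finite_S by auto
    ultimately show "1 \<le> card (l \<inter> {y \<in> S. cls y \<noteq> cls v \<and> cls y \<noteq> k})"
      by (simp add: Suc_le_eq card_gt_0_iff)
  qed
  also have "\<dots> \<le> card {y \<in> S. cls y \<noteq> cls v \<and> cls y \<noteq> k}"
    by (rule sum_card_lines_through) auto
  finally show ?thesis by (simp add: deg_def)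
qed

text \<open>Double counting of pairs and lines. On the diagonal the multiplicity is
  \<open>deg\<close>.\<close>

lemma sum_over_lines:
  fixes g :: "complex ^ 'd \<Rightarrow> complex ^ 'd \<Rightarrow> real"
  shows "(\<Sum>l\<in>lines. \<Sum>u\<in>l. \<Sum>v\<in>l. g u v) = (\<Sum>u\<in>S. \<Sum>v\<in>S. card {l \<in> lines. u \<in> l \<and> v \<in> l} * g u v)"
proof -
  have restrict: "(\<Sum>u\<in>l. h u) = (\<Sum>u\<in>S. if u \<in> l then h u else 0)" if "l \<in> lines" for l and h :: "complex ^ 'd \<Rightarrow> real"
    using line_subset[OF that] finite_S by (simp add: sum.inter_restrict[symmetric] Int_absorb1)
  have "(\<Sum>l\<in>lines. \<Sum>u\<in>l. \<Sum>v\<in>l. g u v) = (\<Sum>l\<in>lines. \<Sum>u\<in>S. \<Sum>v\<in>S. if u \<in> l \<and> v \<in> l then g u v else 0)"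
  proof (rule sum.cong)
    fix l assume l: "l \<in> lines"
    have "(\<Sum>v\<in>S. if u \<in> l \<and> v \<in> l then g u v else 0) = (if u \<in> l then \<Sum>v\<in>l. g u v else 0)" for u
      by (simp add: restrict[OF l])
    then show "(\<Sum>u\<in>l. \<Sum>v\<in>l. g u v) = (\<Sum>u\<in>S. \<Sum>v\<in>S. if u \<in> l \<and> v \<in> l then g u v else 0)"
      by (simp add: restrict[OF l, of "\<lambda>u. \<Sum>v\<in>l. g u v"])
  qed simp
  also have "\<dots> = (\<Sum>u\<in>S. \<Sum>l\<in>lines. \<Sum>v\<in>S. if u \<in> l \<and> v \<in> l then g u v else 0)"
    by (rule sum.swap)
  also have "\<dots> = (\<Sum>u\<in>S. \<Sum>v\<in>S. \<Sum>l\<in>lines. if u \<in> l \<and> v \<in> l then g u v else 0)"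
    by (intro sum.cong refl sum.swap)
  also have "\<dots> = (\<Sum>u\<in>S. \<Sum>v\<in>S. card {l \<in> lines. u \<in> l \<and> v \<in> l} * g u v)"
    using finite_lines by (simp add: sum.inter_filter[symmetric])
  finally show ?thesis .
qed

lemma lines_through_pair:
  assumes "u \<in> S" "v \<in> S" "u \<noteq> v"
  shows "card {l \<in> lines. u \<in> l \<and> v \<in> l} \<le> 1"
    and "cls u \<noteq> cls v \<Longrightarrow> card {l \<in> lines. u \<in> l \<and> v \<in> l} = 1"
proof -
  have sub: "{l \<in> lines. u \<in> l \<and> v \<in> l} \<subseteq> {S \<inter> vec.span {u, v}}"
    using line_eq assms by auto
  show "card {l \<in> lines. u \<in> l \<and> v \<in> l} \<le> 1"
    using card_mono[OF _ sub] by simp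
  assume "cls u \<noteq> cls v"
  then have "S \<inter> vec.span {u, v} \<in> {l \<in> lines. u \<in> l \<and> v \<in> l}"
    using assms by (auto simp: lines_def intro: vec.span_base)
  with sub have "{l \<in> lines. u \<in> l \<and> v \<in> l} = {S \<inter> vec.span {u, v}}" by auto
  then show "card {l \<in> lines. u \<in> l \<and> v \<in> l} = 1" by simp
qed

lemma sum_same_class:
  fixes g :: "complex ^ 'd \<Rightarrow> complex ^ 'd \<Rightarrow> real"
  shows "(\<Sum>u\<in>S. \<Sum>v\<in>S. if cls u = cls v then g u v else 0)
       = (\<Sum>k\<in>cls ` S. \<Sum>u | u \<in> S \<and> cls u = k. \<Sum>v | v \<in> S \<and> cls v = k. g u v)"
proof -
  have "(\<Sum>k\<in>cls ` S. \<Sum>u | u \<in> S \<and> cls u = k. \<Sum>v | v \<in> S \<and> cls v = k. g u v)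
      = (\<Sum>k\<in>cls ` S. \<Sum>u | u \<in> S \<and> cls u = k. \<Sum>v | v \<in> S \<and> cls v = cls u. g u v)"
    by (intro sum.cong) auto
  also have "\<dots> = (\<Sum>u\<in>S. \<Sum>v | v \<in> S \<and> cls v = cls u. g u v)"
    using finite_S by (intro sum.group) auto
  also have "\<dots> = (\<Sum>u\<in>S. \<Sum>v\<in>S. if cls u = cls v then g u v else 0)"
    using finite_S by (simp add: sum.inter_filter eq_commute)
  finally show ?thesis by simp
qed

section \<open>Comparing the frame potential on the lines with that of the whole
  configuration\<close>

text \<open>The tight frame fixes the sum of \<open>K\<close> over all pairs, while the Welch bound
  for planes bounds it from below on each line. Summing over the lines counts pairs of different
  classes once and the diagonal \<open>deg v\<close> times, which brings in the degrees.\<close>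

lemma weighted_line_inequality:
  fixes c :: "complex ^ 'd \<Rightarrow> real" and A :: "complex ^ 'd ^ 'd"
  defines "W \<equiv> \<Sum>v\<in>S. c v" and "f \<equiv> \<Sum>u\<in>S. \<Sum>v\<in>S. if cls u = cls v then c u * c v else 0"
  assumes c: "\<And>v. v \<in> S \<Longrightarrow> c v \<ge> 0" and A: "det A \<noteq> 0"
    and tight: "\<And>i j. (\<Sum>v\<in>S. of_real (c v / (norm (A *v v))\<^sup>2) * ((A *v v) $ i * cnj ((A *v v) $ j)))
           = (if i = j then of_real (W / CARD('d)) else 0)"
  shows "(W\<^sup>2 - f) / 2 \<le> W\<^sup>2 / CARD('d) - f / (2 * CARD('d)) + (\<Sum>v\<in>S. (c v)\<^sup>2 * (real (deg v) - 1)) / 2"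
proof -
  define n where "n v = norm (A *v v)" for v
  define e where "e v = of_real (inverse (n v)) *s (A *v v)" for v
  define K where "K u v = (cmod (hermitian (e u) (e v)))\<^sup>2" for u v
  have npos: "n v > 0" if "v \<in> S" for v
  proof -
    have "A *v v \<noteq> 0"
    proof
      assume "A *v v = 0"
      moreover have "invertible A" using A by (simp add: invertible_det_nz)
      ultimately have "v = 0" by (metis invertible_def matrix_left_invertible_ker)
      then show False using that zero_notin by simp
    qed
    then show ?thesis by (simp add: n_def)
  qed
  have unit: "norm (e v) = 1" if "v \<in> S" for v
  proof -
    have "e v = inverse (n v) *\<^sub>R (A *v v)"
      by (simp add: e_def vec_eq_iff scaleR_conv_of_real[where 'a = complex])
    then show ?thesis using npos[OF that] by (simp add: n_def)
  qed
  have K_le: "K u v \<le> 1" if "u \<in> S" "v \<in> S" for u v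
    using hermitian_bound[of "e u" "e v"] unit[OF that(1)] unit[OF that(2)]
    by (simp add: K_def power_le_one)
  have K_diag: "K v v = 1" if "v \<in> S" for v
    using unit[OF that] by (simp add: K_def hermitian_self)
  have K_nonneg: "K u v \<ge> 0" for u v by (simp add: K_def)

  \<comment> \<open>The frame operator is \<open>W / CARD('d)\<close> times the identity, so its
    squared Hilbert-Schmidt norm is explicit.\<close>
  have total: "(\<Sum>u\<in>S. \<Sum>v\<in>S. c u * c v * K u v) = W\<^sup>2 / CARD('d)"
  proof -
    have "(\<Sum>v\<in>S. of_real (c v) * (e v $ i * cnj (e v $ j))) = (if i = j then of_real (W / CARD('d)) else 0)" for i j
      unfolding tight[symmetric]
      by (intro sum.cong) (simp_all add: e_def n_def power2_eq_square divide_simps)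
    then have "(\<Sum>u\<in>S. \<Sum>v\<in>S. c u * c v * K u v)
        = (\<Sum>i\<in>(UNIV :: 'd set). \<Sum>j\<in>(UNIV :: 'd set). (cmod (if i = j then of_real (W / CARD('d)) else 0))\<^sup>2)"
      unfolding K_def hermitian_def frame_potential_eq[of c "\<lambda>v i. e v $ i"] by simp
    also have "\<dots> = (\<Sum>i\<in>(UNIV :: 'd set). \<Sum>j\<in>(UNIV :: 'd set). if i = j then (W / CARD('d))\<^sup>2 else 0)"
      by (intro sum.cong refl) (simp add: norm_divide power_divide)
    also have "\<dots> = CARD('d) * (W / CARD('d))\<^sup>2" by simp
    finally show ?thesis by (simp add: power2_eq_square)
  qed

  \<comment> \<open>The Welch bound inside each class; \<open>f\<close> is the sum of the squared
    class weights.\<close>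
  have same: "f / CARD('d) \<le> (\<Sum>u\<in>S. \<Sum>v\<in>S. if cls u = cls v then c u * c v * K u v else 0)"
  proof -
    have "f = (\<Sum>k\<in>cls ` S. (\<Sum>u | u \<in> S \<and> cls u = k. c u)\<^sup>2)"
      unfolding f_def sum_same_class by (simp add: power2_eq_square sum_product)
    also have "\<dots> \<le> (\<Sum>k\<in>cls ` S. CARD('d) * (\<Sum>u | u \<in> S \<and> cls u = k. \<Sum>v | v \<in> S \<and> cls v = k. c u * c v * K u v))"
      unfolding K_def by (intro sum_mono frame_potential_space) (simp add: unit)
    also have "\<dots> = CARD('d) * (\<Sum>u\<in>S. \<Sum>v\<in>S. if cls u = cls v then c u * c v * K u v else 0)"
      unfolding sum_same_class by (simp add: sum_distrib_left)
    finally show ?thesis by (simp add: field_simps)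
  qed

  \<comment> \<open>In \<open>H\<close> the number 1/2 of the plane bound replaces \<open>K\<close>
    among all pairs, and \<open>K\<close> within a class is replaced by its upper bound 1. The
    corrections make \<open>G\<close> vanish on the diagonal and \<open>H\<close> on distinct pairs
    of one class, so it is immaterial whether such a pair lies on a line in
    \<open>lines\<close>.\<close>
  define G where "G u v = c u * c v * K u v - (if cls u = cls v then c u * c v * K u v else 0) / 2
      - (if u = v then (c v)\<^sup>2 else 0) / 2" for u v
  define H where "H u v = c u * c v / 2 - (if cls u = cls v then c u * c v else 0) / 2
      - (if u = v then (c v)\<^sup>2 else 0) / 2" for u v
  have G_nonneg: "G u v \<ge> 0" if "u \<in> S" "v \<in> S" for u v
    using that c[OF that(1)] c[OF that(2)] K_nonneg[of u v] K_diag[of u]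
    by (auto simp: G_def power2_eq_square)
  have G_diag: "G v v = 0" if "v \<in> S" for v
    using K_diag[OF that] by (simp add: G_def power2_eq_square)
  have H_same: "H u v = 0" if "cls u = cls v" "u \<noteq> v" for u v
    using that by (simp add: H_def)
  have H_diag: "H v v = - (c v)\<^sup>2 / 2" for v
    by (simp add: H_def power2_eq_square)

  have line: "(\<Sum>u\<in>l. \<Sum>v\<in>l. H u v) \<le> (\<Sum>u\<in>l. \<Sum>v\<in>l. G u v)" if l: "l \<in> lines" for l
  proof -
    obtain x y where xy: "l = S \<inter> vec.span {x, y}" "x \<in> S" "y \<in> S" using l by (auto simp: lines_def)
    have lS: "l \<subseteq> S" using line_subset[OF l] .
    have plane: "\<exists>\<alpha> \<beta>. e w = \<alpha> *s e x + \<beta> *s (A *v y)" if w: "w \<in> l" for w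
    proof -
      have "w \<in> vec.span (insert x {y})" using w xy by simp
      then obtain \<alpha> where "w - \<alpha> *s x \<in> vec.span {y}" by (auto simp: vec.span_breakdown_eq)
      then obtain \<beta> where "w - \<alpha> *s x = \<beta> *s y" by (auto simp: vec.span_singleton)
      then have "w = \<alpha> *s x + \<beta> *s y" by (simp add: algebra_simps)
      then have Aw: "A *v w = \<alpha> *s (A *v x) + \<beta> *s (A *v y)"
        by (simp add: vec.add vec.scale)
      have Ax: "A *v x = of_real (n x) *s e x"
        using npos[OF xy(2)] by (simp add: e_def vec_eq_iff)
      have "e w = (of_real (inverse (n w)) * \<alpha> * of_real (n x)) *s e x + (of_real (inverse (n w)) * \<beta>) *s (A *v y)"
        unfolding e_def[of w] Aw Ax by (simp add: vec.scale_right_distrib mult_ac)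
      then show ?thesis by blast
    qed
    have pot: "(\<Sum>v\<in>l. c v)\<^sup>2 \<le> 2 * (\<Sum>u\<in>l. \<Sum>v\<in>l. c u * c v * K u v)"
      unfolding K_def by (rule frame_potential_plane[OF _ unit[OF xy(2)] plane]) (use lS unit in auto)
    have "(\<Sum>u\<in>l. \<Sum>v\<in>l. H u v) = (\<Sum>v\<in>l. c v)\<^sup>2 / 2
        - (\<Sum>u\<in>l. \<Sum>v\<in>l. (if cls u = cls v then c u * c v else 0) / 2 + (if u = v then (c v)\<^sup>2 else 0) / 2)"
      by (simp add: H_def sum_subtractf sum.distrib power2_eq_square sum_product sum_divide_distrib)
    also have "\<dots> \<le> (\<Sum>u\<in>l. \<Sum>v\<in>l. c u * c v * K u v)
        - (\<Sum>u\<in>l. \<Sum>v\<in>l. (if cls u = cls v then c u * c v * K u v else 0) / 2 + (if u = v then (c v)\<^sup>2 else 0) / 2)"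
    proof (rule diff_mono)
      show "(\<Sum>v\<in>l. c v)\<^sup>2 / 2 \<le> (\<Sum>u\<in>l. \<Sum>v\<in>l. c u * c v * K u v)" using pot by simp
      show "(\<Sum>u\<in>l. \<Sum>v\<in>l. (if cls u = cls v then c u * c v * K u v else 0) / 2 + (if u = v then (c v)\<^sup>2 else 0) / 2)
          \<le> (\<Sum>u\<in>l. \<Sum>v\<in>l. (if cls u = cls v then c u * c v else 0) / 2 + (if u = v then (c v)\<^sup>2 else 0) / 2)"
      proof (intro sum_mono add_right_mono divide_right_mono)
        fix u v assume "u \<in> l" "v \<in> l"
        then have "u \<in> S" "v \<in> S" using lS by auto
        then have "c u * c v * K u v \<le> c u * c v * 1"
          using c K_le by (intro mult_left_mono) auto
        then show "(if cls u = cls v then c u * c v * K u v else 0) \<le> (if cls u = cls v then c u * c v else 0)"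
          by simp
      qed simp
    qed
    also have "\<dots> = (\<Sum>u\<in>l. \<Sum>v\<in>l. G u v)"
      by (simp add: G_def sum_subtractf sum.distrib)
    finally show ?thesis .
  qed

  define N where "N u v = real (card {l \<in> lines. u \<in> l \<and> v \<in> l})" for u v
  have "(\<Sum>u\<in>S. \<Sum>v\<in>S. N u v * H u v) \<le> (\<Sum>u\<in>S. \<Sum>v\<in>S. N u v * G u v)"
    unfolding N_def sum_over_lines[symmetric] by (intro sum_mono line)
  \<comment> \<open>Off the diagonal a pair lies on at most one line and \<open>G\<close> is
    nonnegative; on the diagonal \<open>G\<close> is 0, whatever the degree.\<close>
  also have "\<dots> \<le> (\<Sum>u\<in>S. \<Sum>v\<in>S. G u v)"
  proof (intro sum_mono)
    fix u v assume uv: "u \<in> S" "v \<in> S"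
    show "N u v * G u v \<le> G u v"
    proof (cases "u = v")
      case True
      then show ?thesis using G_diag uv by simp
    next
      case False
      then have "N u v \<le> 1" using lines_through_pair(1)[OF uv] by (simp add: N_def)
      then show ?thesis using G_nonneg[OF uv] mult_right_mono[of "N u v" 1 "G u v"] by simp
    qed
  qed
  also have "\<dots> = (\<Sum>u\<in>S. \<Sum>v\<in>S. c u * c v * K u v)
      - (\<Sum>u\<in>S. \<Sum>v\<in>S. if cls u = cls v then c u * c v * K u v else 0) / 2 - (\<Sum>v\<in>S. (c v)\<^sup>2) / 2"
    using finite_S by (simp add: G_def sum_subtractf sum_divide_distrib[symmetric])
  also have "\<dots> \<le> W\<^sup>2 / CARD('d) - f / (2 * CARD('d)) - (\<Sum>v\<in>S. (c v)\<^sup>2) / 2"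
    using same by (simp add: total)
  finally have upper: "(\<Sum>u\<in>S. \<Sum>v\<in>S. N u v * H u v) \<le> W\<^sup>2 / CARD('d) - f / (2 * CARD('d)) - (\<Sum>v\<in>S. (c v)\<^sup>2) / 2" .

  \<comment> \<open>Multiplicities other than 1 matter for \<open>H\<close> only on the
    diagonal.\<close>
  have "(\<Sum>u\<in>S. \<Sum>v\<in>S. N u v * H u v)
      = (\<Sum>u\<in>S. \<Sum>v\<in>S. H u v + (if u = v then (1 - real (deg v)) * (c v)\<^sup>2 / 2 else 0))"
  proof (intro sum.cong refl)
    fix u v assume uv: "u \<in> S" "v \<in> S"
    consider "u = v" | "u \<noteq> v" "cls u = cls v" | "cls u \<noteq> cls v" by blast
    then show "N u v * H u v = H u v + (if u = v then (1 - real (deg v)) * (c v)\<^sup>2 / 2 else 0)"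
    proof cases
      case 1
      then have "N u v = deg v" by (simp add: N_def deg_def)
      then show ?thesis using 1 by (simp add: H_diag algebra_simps)
    next
      case 2
      then show ?thesis by (simp add: H_same)
    next
      case 3
      then have "u \<noteq> v" by auto
      then have "N u v = 1" using lines_through_pair(2)[OF uv] 3 by (simp add: N_def)
      then show ?thesis using \<open>u \<noteq> v\<close> by simp
    qed
  qed
  also have "\<dots> = (\<Sum>u\<in>S. \<Sum>v\<in>S. H u v) + (\<Sum>v\<in>S. (1 - real (deg v)) * (c v)\<^sup>2 / 2)"
    using finite_S by (simp add: sum.distrib)
  also have "(\<Sum>u\<in>S. \<Sum>v\<in>S. H u v) = W\<^sup>2 / 2 - f / 2 - (\<Sum>v\<in>S. (c v)\<^sup>2) / 2"
    using finite_S
    by (simp add: H_def W_def f_def sum_subtractf sum_divide_distrib[symmetric] power2_eq_square sum_product)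
  also have "(\<Sum>v\<in>S. (1 - real (deg v)) * (c v)\<^sup>2 / 2) = - (\<Sum>v\<in>S. (c v)\<^sup>2 * (real (deg v) - 1)) / 2"
    by (simp add: sum_divide_distrib[symmetric] sum_negf[symmetric] algebra_simps)
  finally show ?thesis using upper by (simp add: diff_divide_distrib)
qed

section \<open>Choice of weights and the bound on the dimension\<close>

text \<open>In dimension at least 5, \<open>weighted_line_inequality\<close> asks for more
  incidences than \<open>two_deg_le\<close> and \<open>deg_le\<close> allow. The largest class, of
  size \<open>m0\<close>, is compared with the \<open>s\<close> points outside it.\<close>

theorem dimension_le_4: "CARD('d) \<le> 4"
proof (rule ccontr)
  assume "\<not> CARD('d) \<le> 4"
  then have d5: "real CARD('d) \<ge> 5" by simp
  define m where "m k = real (card {v \<in> S. cls v = k})" for k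
  have "S \<noteq> {}" using two_classes by blast
  then obtain v0 where v0: "v0 \<in> S" "\<And>v. v \<in> S \<Longrightarrow> m (cls v) \<le> m (cls v0)"
    using finite_S ex_is_arg_min_if_finite[of S "\<lambda>v. - m (cls v)"] by (auto simp: is_arg_min_linorder)
  define k0 where "k0 = cls v0"
  define M where "M = {v \<in> S. cls v = k0}"
  define P where "P = {v \<in> S. cls v \<noteq> k0}"
  define m0 where "m0 = m k0"
  define s where "s = real (card P)"
  define fP where "fP = (\<Sum>v\<in>P. m (cls v))"
  define D0 where "D0 = (\<Sum>v\<in>M. real (deg v))"
  define DP where "DP = (\<Sum>v\<in>P. real (deg v))"
  have fin: "finite M" "finite P" using finite_S by (auto simp: M_def P_def)
  have split: "(\<Sum>v\<in>S. h v) = (\<Sum>v\<in>M. h v) + (\<Sum>v\<in>P. h v)" for h :: "complex ^ 'd \<Rightarrow> real"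
  proof -
    have "S = M \<union> P" "M \<inter> P = {}" by (auto simp: M_def P_def)
    then show ?thesis using fin by (simp add: sum.union_disjoint)
  qed
  have cardM: "real (card M) = m0" by (simp add: M_def m0_def m_def)
  have m0: "m0 > 0"
    using v0(1) finite_S by (auto simp: m0_def m_def k0_def card_gt_0_iff)
  have s: "s > 0"
  proof -
    have "P \<noteq> {}" using two_classes by (auto simp: P_def)
    then show ?thesis using fin by (simp add: s_def card_gt_0_iff)
  qed
  have complement: "real (card {y \<in> S. cls y \<noteq> k}) = m0 + s - m k" for k
  proof -
    have "{y \<in> S. cls y \<noteq> k} = S - {v \<in> S. cls v = k}" by auto
    then have "real (card {y \<in> S. cls y \<noteq> k}) = real (card S) - m k"
      using finite_S by (simp add: card_Diff_subset m_def of_nat_diff card_mono)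
    moreover have "real (card S) = m0 + s"
      using split[of "\<lambda>_. 1"] cardM by (simp add: s_def)
    ultimately show ?thesis by simp
  qed
  have m_P: "m (cls v) \<le> s" if "v \<in> P" for v
    unfolding m_def s_def of_nat_le_iff using that fin by (intro card_mono) (auto simp: P_def)
  have fP_nonneg: "0 \<le> fP"
    by (auto simp: fP_def m_def intro: sum_nonneg)
  have fP_le: "fP \<le> s * s" "fP \<le> m0 * s"
  proof -
    have "fP \<le> (\<Sum>v\<in>P. s)" unfolding fP_def by (intro sum_mono m_P)
    then show "fP \<le> s * s" by (simp add: s_def)
    have "fP \<le> (\<Sum>v\<in>P. m0)"
      unfolding fP_def m0_def k0_def by (intro sum_mono v0(2)) (auto simp: P_def)
    then show "fP \<le> m0 * s" by (simp add: s_def mult.commute)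
  qed
  have deg2: "real (deg v) \<le> (m0 + s - m (cls v)) / 2" if "v \<in> S" for v
  proof -
    have "real (2 * deg v) \<le> real (card {y \<in> S. cls y \<noteq> cls v})"
      using two_deg_le[OF that] unfolding of_nat_le_iff .
    then show ?thesis unfolding complement by simp
  qed
  have D0: "D0 \<le> m0 * s / 2"
  proof -
    have "D0 \<le> (\<Sum>v\<in>M. s / 2)"
      unfolding D0_def
    proof (rule sum_mono)
      fix v assume "v \<in> M"
      then have "v \<in> S" "cls v = k0" by (auto simp: M_def)
      then show "real (deg v) \<le> s / 2" using deg2[of v] by (simp add: m0_def)
    qed
    then show ?thesis using cardM by simp
  qed
  have DP1: "DP \<le> (s * (m0 + s) - fP) / 2"
  proof -
    have "DP \<le> (\<Sum>v\<in>P. (m0 + s - m (cls v)) / 2)"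
      unfolding DP_def using deg2 by (intro sum_mono) (auto simp: P_def)
    also have "\<dots> = (s * (m0 + s) - fP) / 2"
      by (simp add: fP_def s_def sum_subtractf flip: sum_divide_distrib)
    finally show ?thesis .
  qed
  have DP2: "DP \<le> s * s - fP"
  proof -
    have "DP \<le> (\<Sum>v\<in>P. s - m (cls v))"
      unfolding DP_def
    proof (rule sum_mono)
      fix v assume v: "v \<in> P"
      then have "{y \<in> S. cls y \<noteq> cls v \<and> cls y \<noteq> k0} = P - {y \<in> S. cls y = cls v}"
        by (auto simp: P_def)
      moreover have "{y \<in> S. cls y = cls v} \<subseteq> P" using v by (auto simp: P_def)
      ultimately have "real (card {y \<in> S. cls y \<noteq> cls v \<and> cls y \<noteq> k0}) = s - m (cls v)"
        using fin finite_S by (simp add: card_Diff_subset m_def s_def of_nat_diff card_mono)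
      moreover have "real (deg v) \<le> real (card {y \<in> S. cls y \<noteq> cls v \<and> cls y \<noteq> k0})"
        using deg_le[of v k0] v by (simp add: P_def)
      ultimately show "real (deg v) \<le> s - m (cls v)" by simp
    qed
    also have "\<dots> = s * s - fP" by (simp add: fP_def s_def sum_subtractf)
    finally show ?thesis .
  qed

  have main: "((\<omega> * m0 + s)\<^sup>2 - (\<omega>\<^sup>2 * m0\<^sup>2 + fP)) / 2
      \<le> (2 * (\<omega> * m0 + s)\<^sup>2 - (\<omega>\<^sup>2 * m0\<^sup>2 + fP)) / 10 + (\<omega>\<^sup>2 * (D0 - m0) + (DP - s)) / 2"
    if \<omega>: "0 < \<omega>" "\<omega> \<le> 1" for \<omega>
  proof -
    define W where "W = (\<Sum>v\<in>S. weight k0 \<omega> v)"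
    define f where "f = (\<Sum>u\<in>S. \<Sum>v\<in>S. if cls u = cls v then weight k0 \<omega> u * weight k0 \<omega> v else 0)"
    have wM: "weight k0 \<omega> v = \<omega>" if "v \<in> M" for v using that by (simp add: weight_def M_def)
    have wP: "weight k0 \<omega> v = 1" if "v \<in> P" for v using that by (simp add: weight_def P_def)
    have W: "W = \<omega> * m0 + s"
      unfolding W_def split by (simp add: wM wP cardM s_def)
    have f: "f = \<omega>\<^sup>2 * m0\<^sup>2 + fP"
    proof -
      have "(\<Sum>v\<in>S. if cls u = cls v then weight k0 \<omega> u * weight k0 \<omega> v else 0) = m (cls u) * (weight k0 \<omega> u)\<^sup>2" for u
      proof -
        have "(\<Sum>v\<in>S. if cls u = cls v then weight k0 \<omega> u * weight k0 \<omega> v else 0)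
            = (\<Sum>v\<in>S. if cls v = cls u then (weight k0 \<omega> u)\<^sup>2 else 0)"
          by (intro sum.cong) (auto simp: weight_def power2_eq_square)
        then show ?thesis
          using finite_S by (simp add: m_def flip: sum.inter_filter)
      qed
      then have "f = (\<Sum>u\<in>M. m (cls u) * (weight k0 \<omega> u)\<^sup>2) + (\<Sum>u\<in>P. m (cls u) * (weight k0 \<omega> u)\<^sup>2)"
        by (simp add: f_def split)
      also have "(\<Sum>u\<in>M. m (cls u) * (weight k0 \<omega> u)\<^sup>2) = (\<Sum>u\<in>M. m0 * \<omega>\<^sup>2)"
        by (intro sum.cong) (auto simp: weight_def M_def m0_def)
      also have "(\<Sum>u\<in>P. m (cls u) * (weight k0 \<omega> u)\<^sup>2) = fP"
        unfolding fP_def by (intro sum.cong) (auto simp: weight_def P_def)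
      finally show ?thesis using cardM by (simp add: power2_eq_square)
    qed
    have D: "(\<Sum>v\<in>S. (weight k0 \<omega> v)\<^sup>2 * (real (deg v) - 1)) = \<omega>\<^sup>2 * (D0 - m0) + (DP - s)"
      unfolding split
      by (simp add: wM wP D0_def DP_def s_def sum_subtractf cardM flip: sum_distrib_left)
    have "W > 0" unfolding W using s m0 \<omega> by (intro add_pos_pos mult_pos_pos)
    obtain A :: "complex ^ 'd ^ 'd" where A: "det A \<noteq> 0"
      "\<And>i j. (\<Sum>v\<in>S. of_real (weight k0 \<omega> v / (norm (A *v v))\<^sup>2) * ((A *v v) $ i * cnj ((A *v v) $ j)))
           = (if i = j then of_real (W / CARD('d)) else 0)"
    proof (rule exists_tight_frame[OF finite_S spanning zero_notin, of "weight k0 \<omega>" "W / CARD('d)"])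
      show "weight k0 \<omega> v > 0" for v using \<omega> by (simp add: weight_def)
      show "W / CARD('d) > 0" using \<open>W > 0\<close> by simp
      show "(\<Sum>v\<in>S. weight k0 \<omega> v) = W / CARD('d) * CARD('d)" by (simp add: W_def)
      show "(\<Sum>v\<in>S \<inter> vec.span X. weight k0 \<omega> v) < W / CARD('d) * vec.dim X"
        if "X \<subseteq> S" "X \<noteq> {}" "vec.span X \<noteq> UNIV" for X
        unfolding W_def using weights_stable[OF \<omega> _ that] v0(1) k0_def by blast
    qed (rule that)
    have "(W\<^sup>2 - f) / 2 \<le> W\<^sup>2 / CARD('d) - f / (2 * CARD('d)) + (\<Sum>v\<in>S. (weight k0 \<omega> v)\<^sup>2 * (real (deg v) - 1)) / 2"
      unfolding W_def f_def
      by (rule weighted_line_inequality[OF _ A(1) A(2)[unfolded W_def]]) (use \<omega> in \<open>simp add: weight_def\<close>)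
    also have "W\<^sup>2 / CARD('d) - f / (2 * CARD('d)) = (2 * W\<^sup>2 - f) / (2 * CARD('d))"
      by (simp add: field_simps)
    \<comment> \<open>As \<open>f\<close> is at most \<open>W\<^sup>2\<close>, the numerator is
      nonnegative and the dimension may be replaced by 5.\<close>
    also have "\<dots> \<le> (2 * W\<^sup>2 - f) / 10"
    proof (rule divide_left_mono)
      have "0 \<le> \<omega> * m0 * s" using \<omega> m0 s by simp
      then have "f \<le> W\<^sup>2"
        unfolding f W using fP_le(1) by (simp add: power2_eq_square algebra_simps)
      then show "0 \<le> 2 * W\<^sup>2 - f" by (smt (verit) zero_le_power2)
    qed (use d5 in auto)
    finally show ?thesis by (simp only: D W f)
  qed

  show False
  proof (cases "m0 \<le> s")
    case True
    have *: "3 * (m0 + s)\<^sup>2 - 4 * (m0\<^sup>2 + fP) + 5 * (m0 + s) \<le> 5 * (D0 + DP)"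
      using main[of 1] by (simp add: field_simps)
    show False
    proof (cases "3 * (m0\<^sup>2 + fP) \<le> (m0 + s)\<^sup>2")
      \<comment> \<open>Here \<open>two_deg_le\<close> suffices: the estimates combine to
        \<open>(m0 + s)\<^sup>2 + 10 * (m0 + s) \<le> 3 * (m0\<^sup>2 + fP)\<close>.\<close>
      case True
      have "2 * (D0 + DP) \<le> (m0 + s)\<^sup>2 - (m0\<^sup>2 + fP)"
        using D0 DP1 by (simp add: power2_eq_square algebra_simps)
      with * True m0 s show False by argo
    next
      case False
      \<comment> \<open>As \<open>fP \<le> m0 * s\<close>, a large \<open>fP\<close> forces
        \<open>s < 2 * m0\<close>. The product then shown negative is, up to a constant factor, the
        quadratic form left after inserting \<open>D0\<close>, \<open>DP2\<close> and the lower
        bound on \<open>fP\<close>.\<close>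
      have "(m0 + s) * (m0 + s) < 3 * m0 * (m0 + s)"
        using False fP_le(2) by (simp add: power2_eq_square algebra_simps)
      then have "s - 2 * m0 < 0" using m0 s by simp
      moreover have "2 * s - m0 > 0" using True s by simp
      ultimately have "(2 * s - m0) * (s - 2 * m0) < 0" by (rule mult_pos_neg[rotated])
      then have "2 * s * s + 2 * m0 * m0 < 5 * m0 * s" by (simp add: algebra_simps)
      moreover have "2 * (D0 + DP) \<le> m0 * s + 2 * s * s - 2 * fP" using D0 DP2 by simp
      ultimately show False
        using * False m0 s by (simp add: power2_eq_square algebra_simps)
    qed
  next
    case False
    \<comment> \<open>The heavy class receives total weight \<open>s\<close>, as much as its
      complement.\<close>
    define \<omega> where "\<omega> = s / m0"
    have \<omega>: "0 < \<omega>" "\<omega> \<le> 1" "\<omega> * m0 = s" using False m0 s by (auto simp: \<omega>_def)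
    have "\<omega>\<^sup>2 * D0 \<le> \<omega>\<^sup>2 * (m0 * s / 2)" using D0 by (intro mult_left_mono) auto
    also have "\<dots> = \<omega> * (\<omega> * m0) * s / 2" by (simp add: power2_eq_square)
    also have "\<dots> = \<omega> * (s * s) / 2" unfolding \<omega>(3) by simp
    also have "\<dots> \<le> 1 * (s * s) / 2" using \<omega>(2) by (intro divide_right_mono mult_right_mono) auto
    finally have "\<omega>\<^sup>2 * D0 \<le> s * s / 2" by simp
    moreover have "0 \<le> \<omega>\<^sup>2 * m0" using m0 by simp
    moreover have "0 < s * s" using s by simp
    moreover have eqs: "\<omega>\<^sup>2 * m0\<^sup>2 = s * s"
      using \<omega>(3) by (metis power2_eq_square power_mult_distrib)
    moreover have eqs': "(s + s)\<^sup>2 = 4 * (s * s)" "\<omega>\<^sup>2 * (D0 - m0) = \<omega>\<^sup>2 * D0 - \<omega>\<^sup>2 * m0"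
      by (simp_all add: power2_eq_square algebra_simps)
    moreover note main[OF \<omega>(1,2), unfolded \<omega>(3) eqs eqs']
    \<comment> \<open>With these values \<open>main\<close> would force
      \<open>s * s / 2 + fP\<close> to be negative.\<close>
    ultimately show False
      using DP2 fP_nonneg s by argo
  qed
qed

end

section \<open>Reduction to configurations of projective points in dimension five\<close>

theorem theorem3p10:
  fixes k :: nat and L :: "nat \<Rightarrow> (complex ^ 'n) set"
  assumes "k \<ge> 3"
    and "\<And>i. i \<in> {1..k} \<Longrightarrow> finite (L i)"
    and "\<And>i. i \<in> {1..k} \<Longrightarrow> 0 \<notin> L i"
    and "no_sole_nonempty k L"
    and "\<And>i j u v. i \<in> {1..k} \<Longrightarrow> j \<in> {1..k} \<Longrightarrow> i \<noteq> j \<Longrightarrow> u \<in> L i \<Longrightarrow> v \<in> L j \<Longrightarrow>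
           \<not> u \<sim>\<^sub>C v \<Longrightarrow>
           \<exists>t \<in> {1..k} - {i, j}. \<exists>w \<in> L t - (vec.span {u} \<union> vec.span {v}). w \<in> vec.span {u, v}"
  shows "vec.dim (vec.span (\<Union>i\<in>{1..k}. L i)) \<le> 4"
proof (rule ccontr)
  define X where "X = (\<Union>i\<in>{1..k}. L i)"
  assume "\<not> vec.dim (vec.span (\<Union>i\<in>{1..k}. L i)) \<le> 4"
  then have dimX: "vec.dim X \<ge> 5" by (simp add: X_def)
  obtain B where B: "B \<subseteq> X" "vec.independent B" "X \<subseteq> vec.span B" "card B = vec.dim X"
    by (rule vec.basis_exists)
  \<comment> \<open>Five independent vectors of the sets will be sent to the standard basis by
    \<open>f\<close>, so the images span \<open>complex ^ 5\<close>; other vectors may be sent to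
    0.\<close>
  obtain B5 where B5: "B5 \<subseteq> B" "card B5 = 5"
    using obtain_subset_with_card_n[of 5 B] dimX B(4) by auto
  then have finB5: "finite B5" by (simp add: card_ge_0_finite)
  have indB5: "vec.independent B5" using B(2) B5(1) by (rule vec.independent_mono)
  obtain \<phi> :: "complex ^ 'n \<Rightarrow> 5" where \<phi>: "bij_betw \<phi> B5 UNIV"
    using finite_same_card_bij[OF finB5, of "UNIV :: 5 set"] B5(2) by auto
  obtain f :: "complex ^ 'n \<Rightarrow> complex ^ 5" where f: "Vector_Spaces.linear (*s) (*s) f"
    "\<And>b. b \<in> B5 \<Longrightarrow> f b = axis (\<phi> b) 1"
    using vec.linear_independent_extend[OF indB5, of "\<lambda>b. axis (\<phi> b) 1"] by blast
  interpret f: Vector_Spaces.linear "(*s)" "(*s)" f by (rule f(1))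

  \<comment> \<open>\<open>rep x\<close> depends on \<open>x\<close> only through
    \<open>vec.span {x}\<close>, so it picks one vector for each projective point.\<close>
  define rep :: "complex ^ 5 \<Rightarrow> complex ^ 5" where "rep x = (SOME y. vec.span {y} = vec.span {x})" for x
  have span_rep: "vec.span {rep x} = vec.span {x}" for x
    unfolding rep_def by (rule someI) simp
  have rep_eq: "rep x = rep y" if xy: "x \<noteq> 0" "x \<in> vec.span {y}" for x y
  proof -
    obtain a where a: "x = a *s y" using xy(2) by (auto simp: vec.span_singleton)
    then have "a \<noteq> 0" using xy(1) by auto
    then have "y = inverse a *s x" using a by simp
    then have "y \<in> vec.span {x}" by (auto simp: vec.span_singleton)
    then have "vec.span {x} = vec.span {y}"
      using xy(2) by (simp add: vec.span_eq)
    then show ?thesis by (simp add: rep_def)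
  qed
  have rep_mem: "x \<in> vec.span {rep x}" "rep x \<in> vec.span {x}" for x
    using vec.span_base[of x "{x}"] vec.span_base[of "rep x" "{rep x}"] by (simp_all add: span_rep)
  have rep_nz: "rep x \<noteq> 0" if "x \<noteq> 0" for x
    using rep_mem(1)[of x] that by auto

  define S where "S = rep ` (f ` X - {0})"
  \<comment> \<open>\<open>col r\<close> collects the indices of the sets with a vector over the
    point \<open>r\<close>. Points with one and the same single index share a class; a point with
    several indices is a class of its own.\<close>
  define col where "col r = {i \<in> {1..k}. \<exists>x \<in> L i. f x \<noteq> 0 \<and> rep (f x) = r}" for r
  define cls where "cls r = (if \<exists>i. col r = {i} then Inl (the_elem (col r)) else Inr r)" for r
  have col_nonempty: "\<exists>i. i \<in> col r" if "r \<in> S" for r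
    using that by (auto simp: S_def X_def col_def)
  have col_S: "r \<in> S" if r: "i \<in> col r" for i r
  proof -
    obtain x where "i \<in> {1..k}" "x \<in> L i" "f x \<noteq> 0" "r = rep (f x)"
      using r[unfolded col_def] by blast
    then show ?thesis unfolding S_def X_def by blast
  qed
  \<comment> \<open>Equal classes mean the same single index or the same point.\<close>
  have cls_neq: "cls w \<noteq> cls u" if "t \<in> col w" "i \<in> col u" "t \<noteq> i" "w \<noteq> u" for t w i u
    using that by (auto simp: cls_def split: if_splits)

  have "coloured_configuration S cls"
  proof
    have "finite X" using assms(2) by (auto simp: X_def)
    then show "finite S" by (simp add: S_def)
  next
    fix u v assume uv: "u \<in> S" "v \<in> S" "u \<in> vec.span {v}"
    then obtain x y where xy: "u = rep x" "x \<noteq> 0" "v = rep y" "y \<noteq> 0" by (auto simp: S_def)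
    have "u \<in> vec.span {y}" using uv(3) span_rep[of y] xy by simp
    then have "vec.span {u} \<subseteq> vec.span {y}" by (intro vec.span_minimal) auto
    then have "x \<in> vec.span {y}" using rep_mem(1)[of x] xy by auto
    then show "u = v" using rep_eq[of x y] xy by simp
  next
    have "f ` X \<subseteq> vec.span S"
    proof
      fix z assume z: "z \<in> f ` X"
      show "z \<in> vec.span S"
      proof (cases "z = 0")
        case False
        then have "{rep z} \<subseteq> S" using z by (auto simp: S_def)
        then have "vec.span {rep z} \<subseteq> vec.span S" by (rule vec.span_mono)
        then show ?thesis using rep_mem(1)[of z] by auto
      qed (simp add: vec.span_zero)
    qed
    moreover have "axis i 1 \<in> f ` X" for i
    proof -
      obtain b where "b \<in> B5" "\<phi> b = i" using \<phi> by (metis UNIV_I bij_betw_imp_surj_on imageE)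
      then show ?thesis using f(2)[of b] B5(1) B(1) by (metis imageI subsetD)
    qed
    ultimately have "cart_basis \<subseteq> vec.span S" by (auto simp: cart_basis_def)
    then have "vec.span cart_basis \<subseteq> vec.span S" by (intro vec.span_minimal) auto
    then show "vec.span S = UNIV" by (auto simp: span_cart_basis)
  next
    fix u v assume uv: "u \<in> S" "v \<in> S" "cls u \<noteq> cls v"
    \<comment> \<open>Otherwise both points would have the same single index, hence the same
      class.\<close>
    have "\<exists>i j. i \<in> col u \<and> j \<in> col v \<and> i \<noteq> j"
    proof (rule ccontr)
      assume "\<not> ?thesis"
      then have *: "i = j" if "i \<in> col u" "j \<in> col v" for i j using that by blast
      obtain i where "i \<in> col u" using col_nonempty[OF uv(1)] by blast
      moreover obtain j where "j \<in> col v" using col_nonempty[OF uv(2)] by blast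
      ultimately have "col u = {i}" "col v = {i}" using * by blast+
      then show False using uv(3) by (simp add: cls_def)
    qed
    then obtain i j where ij: "i \<in> col u" "j \<in> col v" "i \<noteq> j" by blast
    obtain x where x: "i \<in> {1..k}" "x \<in> L i" "f x \<noteq> 0" "rep (f x) = u" using ij(1) by (auto simp: col_def)
    obtain y where y: "j \<in> {1..k}" "y \<in> L j" "f y \<noteq> 0" "rep (f y) = v" using ij(2) by (auto simp: col_def)
    have uneqv: "u \<noteq> v" using uv(3) by auto
    have fxy: "f x \<notin> vec.span {f y}" "f y \<notin> vec.span {f x}"
      using rep_eq[of "f x" "f y"] rep_eq[of "f y" "f x"] x y uneqv by auto
    have "\<not> x \<sim>\<^sub>C y"
    proof
      assume "x \<sim>\<^sub>C y"
      then have "f y \<in> vec.span {f x}"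
        by (auto simp: proportional_def vec.span_singleton f.scale)
      then show False using fxy by simp
    qed
    from assms(5)[OF x(1) y(1) ij(3) x(2) y(2) this]
    obtain t w where t: "t \<in> {1..k}" "t \<noteq> i" "t \<noteq> j" and w: "w \<in> L t" "w \<notin> vec.span {x}"
      "w \<notin> vec.span {y}" "w \<in> vec.span {x, y}" by blast
    obtain \<alpha> where "w - \<alpha> *s x \<in> vec.span {y}" using w(4) by (auto simp: vec.span_breakdown_eq)
    then obtain \<beta> where "w - \<alpha> *s x = \<beta> *s y" by (auto simp: vec.span_singleton)
    then have wxy: "w = \<alpha> *s x + \<beta> *s y" by (simp add: algebra_simps)
    \<comment> \<open>Both coefficients are nonzero because \<open>w\<close> avoids both spans. This
      survives under \<open>f\<close> and keeps \<open>f w\<close> off the spans of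
      \<open>f x\<close> and \<open>f y\<close>.\<close>
    have "\<alpha> \<noteq> 0" "\<beta> \<noteq> 0" using w(2,3) unfolding wxy by (auto simp: vec.span_singleton)
    have fw: "f w = \<alpha> *s f x + \<beta> *s f y" unfolding wxy by (simp add: f.add f.scale)
    have "f y = inverse \<beta> *s (\<beta> *s f y)" using \<open>\<beta> \<noteq> 0\<close> by simp
    also have "\<beta> *s f y = f w - \<alpha> *s f x" by (simp add: fw)
    finally have fy: "f y = inverse \<beta> *s (f w - \<alpha> *s f x)" .
    have "f x = inverse \<alpha> *s (\<alpha> *s f x)" using \<open>\<alpha> \<noteq> 0\<close> by simp
    also have "\<alpha> *s f x = f w - \<beta> *s f y" by (simp add: fw)
    finally have fx: "f x = inverse \<alpha> *s (f w - \<beta> *s f y)" .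
    have not_x: "f w \<notin> vec.span {f x}"
    proof
      assume "f w \<in> vec.span {f x}"
      then have "f y \<in> vec.span {f x}"
        unfolding fy by (intro vec.span_scale vec.span_diff) (auto intro: vec.span_base)
      then show False using fxy by simp
    qed
    have not_y: "f w \<notin> vec.span {f y}"
    proof
      assume "f w \<in> vec.span {f y}"
      then have "f x \<in> vec.span {f y}"
        unfolding fx by (intro vec.span_scale vec.span_diff) (auto intro: vec.span_base)
      then show False using fxy by simp
    qed
    have "f w \<noteq> 0" using not_x by (auto simp: vec.span_zero)
    define r where "r = rep (f w)"
    have tr: "t \<in> col r" using t w(1) \<open>f w \<noteq> 0\<close> by (auto simp: col_def r_def)
    have "r \<noteq> u" "r \<noteq> v"
      using not_x not_y span_rep[of "f w"] span_rep[of "f x"] span_rep[of "f y"] x(4) y(4)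
        vec.span_base[of "f w" "{f w}"] by (auto simp: r_def)
    moreover have "r \<in> vec.span {u, v}"
    proof -
      have "f x \<in> vec.span {u, v}" "f y \<in> vec.span {u, v}"
        using rep_mem(1)[of "f x"] rep_mem(1)[of "f y"] x(4) y(4)
          vec.span_mono[of "{u}" "{u, v}"] vec.span_mono[of "{v}" "{u, v}"] by auto
      then have "f w \<in> vec.span {u, v}"
        unfolding fw by (intro vec.span_add vec.span_scale)
      then have "vec.span {f w} \<subseteq> vec.span {u, v}" by (intro vec.span_minimal) auto
      then show ?thesis using rep_mem(2)[of "f w"] by (auto simp: r_def)
    qed
    ultimately show "\<exists>w\<in>S. cls w \<noteq> cls u \<and> cls w \<noteq> cls v \<and> w \<in> vec.span {u, v}"
      using cls_neq[OF tr ij(1)] cls_neq[OF tr ij(2)] t col_S[OF tr] by blast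
  next
    \<comment> \<open>With one class only, all points have a single index \<open>i\<close>. By
      \<open>no_sole_nonempty\<close> another set has a vector \<open>y\<close>, which
      \<open>f\<close> must kill; then the third vector \<open>w\<close> for \<open>x\<close> and
      \<open>y\<close> has a nonzero image and an index other than \<open>i\<close>.\<close>
    show "\<exists>u\<in>S. \<exists>v\<in>S. cls u \<noteq> cls v"
    proof (rule ccontr)
      assume "\<not> ?thesis"
      then have same: "cls u = cls v" if "u \<in> S" "v \<in> S" for u v using that by blast
      obtain b1 b2 where b: "b1 \<in> B5" "b2 \<in> B5" "b1 \<noteq> b2"
        using B5(2) card_le_Suc0_iff_eq[OF finB5] by auto
      define u where "u = rep (f b1)"
      have fb: "f b1 \<noteq> 0" "f b2 \<noteq> 0" using b f(2) by (auto simp: axis_eq_0_iff)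
      have bX: "b1 \<in> X" "b2 \<in> X" using b B5(1) B(1) by auto
      have uS: "u \<in> S" "rep (f b2) \<in> S" using fb bX by (auto simp: S_def u_def)
      have "u \<noteq> rep (f b2)"
      proof
        assume "u = rep (f b2)"
        then have "f b1 \<in> vec.span {f b2}"
          using rep_mem(1)[of "f b1"] span_rep[of "f b2"] by (simp add: u_def)
        then obtain a where "f b1 = a *s f b2" by (auto simp: vec.span_singleton)
        then have "f b1 $ \<phi> b1 = a * f b2 $ \<phi> b1" by simp
        moreover have "\<phi> b1 \<noteq> \<phi> b2" using b \<phi> by (metis bij_betw_imp_inj_on inj_onD)
        ultimately show False using b f(2) by (simp add: axis_def)
      qed
      \<comment> \<open>Distinct points cannot share a class of the form \<open>Inr\<close>, so the
        common class comes from a single index.\<close>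
      then obtain i where i: "col u = {i}"
        using same[OF uS] by (auto simp: cls_def split: if_splits)
      have colS: "t = i" if "t \<in> col r" for t r
      proof (cases "r = u")
        case True
        then show ?thesis using that i by simp
      next
        case False
        then show ?thesis using cls_neq[OF that, of i u] same[OF col_S[OF that] uS(1)] i by auto
      qed
      obtain x where x: "i \<in> {1..k}" "x \<in> L i" "f x \<noteq> 0" using i by (auto simp: col_def)
      obtain j y where y: "j \<in> {1..k}" "j \<noteq> i" "y \<in> L j"
        using assms(4) x(1,2) unfolding no_sole_nonempty_def by blast
      have fy: "f y = 0"
      proof (rule ccontr)
        assume "f y \<noteq> 0"
        then have "j \<in> col (rep (f y))" using y by (auto simp: col_def)
        then show False using colS y(2) by auto
      qed
      have "\<not> x \<sim>\<^sub>C y"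
      proof
        assume "x \<sim>\<^sub>C y"
        then obtain a where a: "y = a *s x" by (auto simp: proportional_def vec.span_singleton)
        moreover have "y \<noteq> 0" using y assms(3)[of j] by auto
        ultimately have "a \<noteq> 0" by auto
        then show False using fy x(3) by (simp add: a f.scale)
      qed
      from assms(5)[OF x(1) y(1) y(2)[symmetric] x(2) y(3) this]
      obtain t w where t: "t \<in> {1..k}" "t \<noteq> i" and w: "w \<in> L t" "w \<notin> vec.span {y}" "w \<in> vec.span {x, y}"
        by blast
      obtain \<alpha> where \<alpha>: "w - \<alpha> *s x \<in> vec.span {y}" using w(3) by (auto simp: vec.span_breakdown_eq)
      then have "\<alpha> \<noteq> 0" using w(2) by auto
      obtain \<beta> where "w - \<alpha> *s x = \<beta> *s y" using \<alpha> by (auto simp: vec.span_singleton)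
      then have "w = \<alpha> *s x + \<beta> *s y" by (simp add: algebra_simps)
      then have "f w = \<alpha> *s f x" by (simp add: f.add f.scale fy)
      then have "f w \<noteq> 0" using \<open>\<alpha> \<noteq> 0\<close> x(3) by simp
      then have "t \<in> col (rep (f w))" using t(1) w(1) by (auto simp: col_def)
      then show False using colS t(2) by auto
    qed
  qed
  then have "CARD(5) \<le> 4" by (rule coloured_configuration.dimension_le_4)
  then show False by simp
qed

end
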